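(* Let $(\mathfrak g,J,g)$ be a four dimensional Kähler Lie algebra. If $\mathfrak g$ does not admit an Einstein Kähler metric (i.e. no pseudo-Kähler metric on $\mathfrak g$, for any complex structure on $\mathfrak g$, is Einstein), then $\mathfrak g$ is isomorphic to $\mathbb R^2\times\mathfrak{aff}(\mathbb R)$, to $\mathfrak r'_{4,0,\delta}$ for some $\delta>0$, or to $\mathfrak d_{4,1}$.
   Context: All Lie algebras are real. A complex structure is an endomorphism $J$ with $J^2=-I$ and $[Jx,Jy]-[x,y]-J[Jx,y]-J[x,Jy]=0$. A Kähler Lie algebra is a Lie algebra with a complex structure $J$ and a closed nondegenerate 2-form $\omega$ (closed: $\omega([x,y],z)+\omega([y,z],x)+\omega([z,x],y)=0$) with $\omega(Jx,Jy)=\omega(x,y)$; the associated pseudo-Kähler metric is $g(x,y)=\omega(Jx,y)$, not necessarily definite, and one writes $(\mathfrak g,J,g)$. The Levi-Civita connection is given by $2g(\nabla_xy,z)=g([x,y],z)-g([y,z],x)+g([z,x],y)$, the curvature by $R(x,y)=[\nabla_x,\nabla_y]-\nabla_{[x,y]}$, the Ricci tensor by $ric(x,y)=-\sum_i\varepsilon_i\,g(R(x,v_i)y,v_i)$ for an orthonormal basis $\{v_i\}$, $\varepsilon_i=g(v_i,v_i)=\pm1$. $g$ is Einstein if $ric=\nu g$ for a real constant $\nu$ (so Ricci flat metrics, $\nu=0$, are Einstein). In a basis $e_1,\dots,e_4$ with the nonzero brackets: $\mathbb R^2\times\mathfrak{aff}(\mathbb R)$: $[e_1,e_2]=e_2$.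 $\mathfrak r'_{4,0,\delta}$: $[e_4,e_1]=e_1$, $[e_4,e_2]=-\delta e_3$, $[e_4,e_3]=\delta e_2$. $\mathfrak d_{4,1}$: $[e_1,e_2]=e_3$, $[e_4,e_3]=e_3$, $[e_4,e_1]=e_1$. *)

theory Defs
  imports "HOL-Analysis.Analysis"
begin

definition lie_bracket :: "('a::real_vector \<Rightarrow> 'a \<Rightarrow> 'a) \<Rightarrow> bool" where
  "lie_bracket br \<longleftrightarrow> bilinear br \<and> (\<forall>x. br x x = 0) \<and>
     (\<forall>x y z. br (br x y) z + br (br y z) x + br (br z x) y = 0)"

definition lie_isomorphic ::
  "('a::real_vector \<Rightarrow> 'a \<Rightarrow> 'a) \<Rightarrow> ('b::real_vector \<Rightarrow> 'b \<Rightarrow> 'b) \<Rightarrow> bool" where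
  "lie_isomorphic br br' \<longleftrightarrow>
     (\<exists>f. linear f \<and> bij f \<and> (\<forall>x y. f (br x y) = br' (f x) (f y)))"

definition complex_structure ::
  "('a::real_vector \<Rightarrow> 'a \<Rightarrow> 'a) \<Rightarrow> ('a \<Rightarrow> 'a) \<Rightarrow> bool" where
  "complex_structure br J \<longleftrightarrow> linear J \<and> (\<forall>x. J (J x) = - x) \<and>
     (\<forall>x y. br (J x) (J y) - br x y - J (br (J x) y) - J (br x (J y)) = 0)"

definition symplectic_form ::
  "('a::real_vector \<Rightarrow> 'a \<Rightarrow> 'a) \<Rightarrow> ('a \<Rightarrow> 'a \<Rightarrow> real) \<Rightarrow> bool" where
  "symplectic_form br \<omega> \<longleftrightarrow> bilinear \<omega> \<and> (\<forall>x. \<omega> x x = 0) \<and>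
     (\<forall>x. (\<forall>y. \<omega> x y = 0) \<longrightarrow> x = 0) \<and>
     (\<forall>x y z. \<omega> (br x y) z + \<omega> (br y z) x + \<omega> (br z x) y = 0)"

definition kaehler_metric :: "('a \<Rightarrow> 'a) \<Rightarrow> ('a \<Rightarrow> 'a \<Rightarrow> real) \<Rightarrow> 'a \<Rightarrow> 'a \<Rightarrow> real" where
  "kaehler_metric J \<omega> x y = \<omega> (J x) y"

text \<open>The structure \<open>(br, J, g)\<close>; no definiteness of \<open>g\<close> is required. The form \<open>\<omega>\<close> is
  determined by \<open>J\<close> and \<open>g\<close>.\<close>

definition kaehler_lie_algebra ::
  "('a::real_vector \<Rightarrow> 'a \<Rightarrow> 'a) \<Rightarrow> ('a \<Rightarrow> 'a) \<Rightarrow> ('a \<Rightarrow> 'a \<Rightarrow> real) \<Rightarrow> bool" where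
  "kaehler_lie_algebra br J g \<longleftrightarrow> lie_bracket br \<and> complex_structure br J \<and>
     (\<exists>\<omega>. symplectic_form br \<omega> \<and> (\<forall>x y. \<omega> (J x) (J y) = \<omega> x y) \<and> g = kaehler_metric J \<omega>)"

text \<open>For nondegenerate \<open>g\<close> in finite dimension the Koszul formula has exactly one solution,
  so the definite description below is proper.\<close>

definition levi_civita ::
  "('a::real_vector \<Rightarrow> 'a \<Rightarrow> 'a) \<Rightarrow> ('a \<Rightarrow> 'a \<Rightarrow> real) \<Rightarrow> 'a \<Rightarrow> 'a \<Rightarrow> 'a" where
  "levi_civita br g x y =
     (THE w. \<forall>z. 2 * g w z = g (br x y) z - g (br y z) x + g (br z x) y)"

definition curvature ::
  "('a::real_vector \<Rightarrow> 'a \<Rightarrow> 'a) \<Rightarrow> ('a \<Rightarrow> 'a \<Rightarrow> real) \<Rightarrow> 'a \<Rightarrow> 'a \<Rightarrow> 'a \<Rightarrow> 'a" where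
  "curvature br g x y z =
     levi_civita br g x (levi_civita br g y z) - levi_civita br g y (levi_civita br g x z)
       - levi_civita br g (br x y) z"

definition pseudo_orthonormal_basis :: "('a::real_vector \<Rightarrow> 'a \<Rightarrow> real) \<Rightarrow> 'a set \<Rightarrow> bool" where
  "pseudo_orthonormal_basis g B \<longleftrightarrow> independent B \<and> span B = UNIV \<and>
     (\<forall>v\<in>B. g v v = 1 \<or> g v v = -1) \<and> (\<forall>u\<in>B. \<forall>v\<in>B. u \<noteq> v \<longrightarrow> g u v = 0)"

text \<open>The Ricci tensor is computed in a basis \<open>B\<close>; the value is the same for every
  pseudo-orthonormal basis, as lemma \<open>ricci_basis_independent\<close> shows.\<close>

definition ricci ::
  "'a set \<Rightarrow> ('a::real_vector \<Rightarrow> 'a \<Rightarrow> 'a) \<Rightarrow> ('a \<Rightarrow> 'a \<Rightarrow> real) \<Rightarrow> 'a \<Rightarrow> 'a \<Rightarrow> real" where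
  "ricci B br g x y = - (\<Sum>v\<in>B. g v v * g (curvature br g x v y) v)"

definition einstein ::
  "('a::real_vector \<Rightarrow> 'a \<Rightarrow> 'a) \<Rightarrow> ('a \<Rightarrow> 'a \<Rightarrow> real) \<Rightarrow> bool" where
  "einstein br g \<longleftrightarrow>
     (\<exists>B \<nu>. pseudo_orthonormal_basis g B \<and> (\<forall>x y. ricci B br g x y = \<nu> * g x y))"

lemma sum_pseudo_orthonormal:
  assumes g: "bilinear g" and B: "pseudo_orthonormal_basis g B" "finite B"
  shows "(\<Sum>v\<in>B. (g v v * g w v) *\<^sub>R v) = w"
proof -
  have orth: "g u v = 0" if "u \<in> B" "v \<in> B" "u \<noteq> v" for u v
    using B that by (auto simp: pseudo_orthonormal_basis_def)
  have sq: "g v v * g v v = 1" if "v \<in> B" for v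
    using B that unfolding pseudo_orthonormal_basis_def by (metis mult_1 mult_minus1 minus_minus)
  have lg: "linear (\<lambda>x. g x v)" for v
    using g by (simp add: bilinear_def)
  have "w \<in> span B" using B by (simp add: pseudo_orthonormal_basis_def)
  then obtain c where c: "w = (\<Sum>v\<in>B. c v *\<^sub>R v)"
    using span_finite[OF B(2)] by auto
  have "g w v = c v * g v v" if "v \<in> B" for v
  proof -
    have "g w v = (\<Sum>u\<in>B. c u * g u v)"
      unfolding c by (simp add: linear_sum[OF lg] linear_cmul[OF lg])
    also have "\<dots> = (\<Sum>u\<in>B. if u = v then c v * g v v else 0)"
      using orth that by (intro sum.cong) auto
    also have "\<dots> = c v * g v v" using that B(2) by simp
    finally show ?thesis .
  qed
  then have "(\<Sum>v\<in>B. (g v v * g w v) *\<^sub>R v) = (\<Sum>v\<in>B. c v *\<^sub>R v)"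
    using sq by (intro sum.cong) (auto simp: algebra_simps)
  then show ?thesis by (simp add: c)
qed

lemma levi_civita_unique:
  assumes br: "bilinear br" and g: "bilinear g" "\<And>x y. g x y = g y x"
    and B: "pseudo_orthonormal_basis g B" "finite B"
  shows "w = levi_civita br g x y \<longleftrightarrow>
    (\<forall>z. 2 * g w z = g (br x y) z - g (br y z) x + g (br z x) y)"
proof -
  define k where "k z = (g (br x y) z - g (br y z) x + g (br z x) y) / 2" for z
  have lg: "linear (\<lambda>x. g x v)" "linear (g v)" for v
    using g(1) by (auto simp: bilinear_def)
  have lb: "linear (\<lambda>x. br x v)" "linear (br v)" for v
    using br by (auto simp: bilinear_def)
  have k: "linear k"
    unfolding k_def
    by (rule linearI)
      (simp_all add: linear_add[OF lb(1)] linear_add[OF lb(2)] linear_add[OF lg(1)]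
        linear_add[OF lg(2)] linear_cmul[OF lb(1)] linear_cmul[OF lb(2)] linear_cmul[OF lg(1)]
        linear_cmul[OF lg(2)] field_simps)
  define w0 where "w0 = (\<Sum>v\<in>B. (g v v * k v) *\<^sub>R v)"
  have ex: "g w0 z = k z" for z
  proof -
    have "k z = k (\<Sum>v\<in>B. (g v v * g z v) *\<^sub>R v)"
      by (simp add: sum_pseudo_orthonormal[OF g(1) B])
    also have "\<dots> = (\<Sum>v\<in>B. g v v * g z v * k v)"
      by (simp add: linear_sum[OF k] linear_cmul[OF k])
    also have "\<dots> = g w0 z"
      unfolding w0_def by (simp add: linear_sum[OF lg(1)] linear_cmul[OF lg(1)] g(2)[of z] mult_ac)
    finally show ?thesis by simp
  qed
  have un: "u = w0" if "\<And>z. g u z = k z" for u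
    using sum_pseudo_orthonormal[OF g(1) B, of u] by (simp add: that w0_def)
  have iff: "(\<forall>z. 2 * g u z = g (br x y) z - g (br y z) x + g (br z x) y) \<longleftrightarrow> u = w0" for u
  proof -
    have "(\<forall>z. 2 * g u z = g (br x y) z - g (br y z) x + g (br z x) y) \<longleftrightarrow> (\<forall>z. g u z = k z)"
      by (simp add: k_def field_simps)
    then show ?thesis using ex un by blast
  qed
  show ?thesis by (simp add: levi_civita_def iff)
qed

lemma bilinear_levi_civita:
  assumes br: "bilinear br" and g: "bilinear g" "\<And>x y. g x y = g y x"
    and B: "pseudo_orthonormal_basis g B" "finite B"
  shows "bilinear (levi_civita br g)"
proof -
  let ?D = "levi_civita br g"
  note uq = levi_civita_unique[OF br g B]
  have D: "2 * g (?D x y) z = g (br x y) z - g (br y z) x + g (br z x) y" for x y z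
    using uq by blast
  note rules = bilinear_ladd[OF br] bilinear_radd[OF br] bilinear_lmul[OF br] bilinear_rmul[OF br]
    bilinear_ladd[OF g(1)] bilinear_radd[OF g(1)] bilinear_lmul[OF g(1)] bilinear_rmul[OF g(1)]
  have "?D x y + ?D x' y = ?D (x + x') y" for x x' y
    unfolding uq by (auto simp: rules D algebra_simps)
  moreover have "?D x y + ?D x y' = ?D x (y + y')" for x y y'
    unfolding uq by (auto simp: rules D algebra_simps)
  moreover have "c *\<^sub>R ?D x y = ?D (c *\<^sub>R x) y" for c x y
    unfolding uq by (simp add: rules mult.left_commute[of 2] D) (simp add: algebra_simps)
  moreover have "c *\<^sub>R ?D x y = ?D x (c *\<^sub>R y)" for c x y
    unfolding uq by (simp add: rules mult.left_commute[of 2] D) (simp add: algebra_simps)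
  ultimately show ?thesis
    by (simp add: bilinear_def linear_iff)
qed

lemma ricci_basis_independent:
  assumes br: "bilinear br" and g: "bilinear g" "\<And>x y. g x y = g y x"
    and B: "pseudo_orthonormal_basis g B" "finite B"
    and C: "pseudo_orthonormal_basis g C" "finite C"
  shows "ricci B br g x y = ricci C br g x y"
proof -
  note D = bilinear_levi_civita[OF br g B]
  define b where "b v w = g (curvature br g x v y) w" for v w
  note rules = bilinear_ladd[OF br] bilinear_radd[OF br] bilinear_lmul[OF br] bilinear_rmul[OF br]
    bilinear_ladd[OF g(1)] bilinear_radd[OF g(1)] bilinear_lmul[OF g(1)] bilinear_rmul[OF g(1)]
    bilinear_ladd[OF D] bilinear_radd[OF D] bilinear_lmul[OF D] bilinear_rmul[OF D]
    bilinear_lsub[OF g(1)]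
  have l1: "linear (\<lambda>v. b v w)" for w
    by (rule linearI) (simp_all add: b_def curvature_def rules algebra_simps)
  have l2: "linear (b v)" for v
    by (rule linearI) (simp_all add: b_def rules)
  have "(\<Sum>v\<in>B. g v v * b v v) = (\<Sum>v\<in>B. g v v * b (\<Sum>w\<in>C. (g w w * g v w) *\<^sub>R w) v)"
    by (simp add: sum_pseudo_orthonormal[OF g(1) C])
  also have "\<dots> = (\<Sum>v\<in>B. \<Sum>w\<in>C. g v v * (g w w * g v w * b w v))"
    by (simp add: linear_sum[OF l1] linear_cmul[OF l1] sum_distrib_left)
  also have "\<dots> = (\<Sum>w\<in>C. \<Sum>v\<in>B. g w w * (g v v * g w v * b w v))"
    by (subst sum.swap) (simp add: g(2) mult_ac)
  also have "\<dots> = (\<Sum>w\<in>C. g w w * b w (\<Sum>v\<in>B. (g v v * g w v) *\<^sub>R v))"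
    by (simp add: linear_sum[OF l2] linear_cmul[OF l2] sum_distrib_left)
  also have "\<dots> = (\<Sum>w\<in>C. g w w * b w w)"
    by (simp add: sum_pseudo_orthonormal[OF g(1) B])
  finally show ?thesis by (simp add: ricci_def b_def)
qed

text \<open>In the models below \<open>axis i 1\<close> is the basis vector \<open>e\<^sub>i\<close> of \<open>real ^ 4\<close>.\<close>

definition br_R2_aff :: "real ^ 4 \<Rightarrow> real ^ 4 \<Rightarrow> real ^ 4" where
  "br_R2_aff x y = (x $ 1 * y $ 2 - x $ 2 * y $ 1) *\<^sub>R axis 2 1"

definition br_r'_40 :: "real \<Rightarrow> real ^ 4 \<Rightarrow> real ^ 4 \<Rightarrow> real ^ 4" where
  "br_r'_40 \<delta> x y =
     (x $ 4 * y $ 1 - x $ 1 * y $ 4) *\<^sub>R axis 1 1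
     + (x $ 4 * y $ 2 - x $ 2 * y $ 4) *\<^sub>R (- \<delta> *\<^sub>R axis 3 1)
     + (x $ 4 * y $ 3 - x $ 3 * y $ 4) *\<^sub>R (\<delta> *\<^sub>R axis 2 1)"

definition br_d_41 :: "real ^ 4 \<Rightarrow> real ^ 4 \<Rightarrow> real ^ 4" where
  "br_d_41 x y =
     (x $ 1 * y $ 2 - x $ 2 * y $ 1) *\<^sub>R axis 3 1
     + (x $ 4 * y $ 3 - x $ 3 * y $ 4) *\<^sub>R axis 3 1
     + (x $ 4 * y $ 1 - x $ 1 * y $ 4) *\<^sub>R axis 1 1"

end

theory Submission
  imports Defs
begin

text \<open>
  On a Lie algebra with complex structure \<open>J\<close> put \<open>\<psi> x = tr (ad (J x)) - tr (J \<circ> ad x)\<close> (the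
  Koszul form). For a pseudo-Kaehler metric the Ricci tensor satisfies
  \<open>ric x (J y) = - \<psi> [x, y] / 2\<close>, so the Ricci form, up to a factor the exact form
  \<open>\<theta> x y = \<psi> [x, y]\<close>, depends on \<open>J\<close> only and not on the metric. This settles two of three cases
  for the given structure \<open>J\<close>. If \<open>\<theta> = 0\<close>, the given metric is Ricci flat. If \<open>\<theta>\<close> is
  nondegenerate, then \<open>\<theta>\<close>, which is closed and \<open>J\<close>-invariant, is itself the Kaehler form of a
  pseudo-Kaehler metric, whose Ricci form is again \<open>\<theta>\<close>; that metric is Einstein.

  In dimension four there remains the case in which \<open>\<theta>\<close> has rank two. Its kernel is a complex line
  \<open>K\<close>, and a subalgebra because \<open>\<theta>\<close> is closed. Let \<open>\<omega>\<close> be the Kaehler form.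

  If \<open>\<omega>\<close> is nondegenerate on \<open>K\<close>, its complement \<open>L\<close> is a subalgebra too and each of \<open>K\<close>, \<open>L\<close>
  acts on the other by trace-free maps. \<open>L\<close> is not abelian since \<open>\<theta>\<close> does not vanish on it. The
  Jacobi identity forces \<open>K\<close> to act trivially and leaves for \<open>L\<close> either rotations of \<open>K\<close>,
  possibly trivial ones (giving
  \<open>\<real>\<^sup>2 \<times> aff(\<real>)\<close> and \<open>r'\<^sub>4\<^sub>,\<^sub>0\<^sub>,\<^sub>\<delta>\<close>) or one hyperbolic action, which gives the algebra
  \<open>d\<^sub>4\<^sub>,\<^sub>2\<close>; the latter carries a Ricci flat pseudo-Kaehler metric for another complex structure
  (\<open>d42_ricci_flat\<close>).

  If \<open>K\<close> is isotropic, it is Lagrangian, the closedness of \<open>\<omega>\<close> makes it an abelian ideal, and the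
  only algebra of this kind with \<open>\<theta> \<noteq> 0\<close> is \<open>d\<^sub>4\<^sub>,\<^sub>1\<close>.
\<close>

section \<open>Traces and frames\<close>

text \<open>A trace on a space without chosen inner product: the value in one arbitrary basis, which by
  \<open>lin_trace_frame\<close> is the value in every frame.\<close>

definition lin_trace :: "('a::real_vector \<Rightarrow> 'a) \<Rightarrow> real" where
  "lin_trace F = (\<Sum>b\<in>extend_basis {}. representation (extend_basis {}) (F b) b)"

text \<open>Expanding each \<open>F (e i)\<close> in the second frame and exchanging the sums turns one trace into the
  other. A frame may be a basis with its dual basis, or a pseudo-orthonormal basis with the
  functionals \<open>\<lambda>x. g v v * g x v\<close>.\<close>

lemma frame_trace_independent:
  assumes F: "linear F"
    and f: "\<And>i. i \<in> I \<Longrightarrow> linear (f i)" and e: "\<And>x. (\<Sum>i\<in>I. f i x *\<^sub>R e i) = x"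
    and f': "\<And>j. j \<in> I' \<Longrightarrow> linear (f' j)" and e': "\<And>x. (\<Sum>j\<in>I'. f' j x *\<^sub>R e' j) = x"
  shows "(\<Sum>i\<in>I. f i (F (e i))) = (\<Sum>j\<in>I'. f' j (F (e' j)))"
proof -
  have "(\<Sum>i\<in>I. f i (F (e i))) = (\<Sum>i\<in>I. f i (\<Sum>j\<in>I'. f' j (F (e i)) *\<^sub>R e' j))"
    by (simp only: e')
  also have "\<dots> = (\<Sum>i\<in>I. \<Sum>j\<in>I'. f' j (F (e i)) * f i (e' j))"
    by (intro sum.cong refl) (simp add: linear_sum[OF f] linear_cmul[OF f])
  also have "\<dots> = (\<Sum>j\<in>I'. \<Sum>i\<in>I. f i (e' j) * f' j (F (e i)))"
    by (subst sum.swap) (simp add: mult.commute)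
  also have "\<dots> = (\<Sum>j\<in>I'. f' j (F (\<Sum>i\<in>I. f i (e' j) *\<^sub>R e i)))"
    by (intro sum.cong refl)
      (simp add: linear_sum[OF F] linear_cmul[OF F] linear_sum[OF f'] linear_cmul[OF f'])
  also have "\<dots> = (\<Sum>j\<in>I'. f' j (F (e' j)))" by (simp only: e)
  finally show ?thesis .
qed

lemma basis_frame:
  fixes B :: "'a::real_vector set"
  assumes B: "independent B" "span B = UNIV" "finite B"
  shows "linear (\<lambda>x. representation B x b)" "(\<Sum>b\<in>B. representation B x b *\<^sub>R b) = x"
proof -
  show "linear (\<lambda>x. representation B x b)"
    by (rule linearI) (use B in \<open>simp_all add: real_vector.representation_add real_vector.representation_scale\<close>)
  show "(\<Sum>b\<in>B. representation B x b *\<^sub>R b) = x"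
    using real_vector.sum_representation_eq[OF B(1), of x B] B by simp
qed

lemma finite_basis:
  fixes B :: "'a::real_vector set"
  assumes "dim (UNIV :: 'a set) = 4" "independent B" "span B = UNIV"
  shows "finite B" "card B = 4"
proof -
  have "dim (UNIV :: 'a set) = card B"
    using real_vector.dim_eq_card[of B UNIV] assms by simp
  then show "card B = 4" using assms by simp
  then show "finite B" using card.infinite by fastforce
qed

lemma default_basis:
  "independent (extend_basis {} :: 'a::real_vector set)" "span (extend_basis {} :: 'a set) = UNIV"
  using real_vector.independent_extend_basis real_vector.span_extend_basis
    real_vector.independent_empty by blast+

lemma lin_trace_frame:
  fixes F :: "'a::real_vector \<Rightarrow> 'a"
  assumes dim: "dim (UNIV :: 'a set) = 4" and F: "linear F"
    and f: "\<And>i. i \<in> I \<Longrightarrow> linear (f i)" and e: "\<And>x. (\<Sum>i\<in>I. f i x *\<^sub>R e i) = x"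
  shows "lin_trace F = (\<Sum>i\<in>I. f i (F (e i)))"
proof -
  let ?B = "extend_basis {} :: 'a set"
  note B = default_basis
  note fin = finite_basis(1)[OF dim B]
  show ?thesis unfolding lin_trace_def
    by (rule frame_trace_independent[OF F _ _ f e]) (use basis_frame[OF B fin] in auto)
qed

lemma lin_trace_add: 
  fixes F :: "'a::real_vector \<Rightarrow> 'a"
  shows "lin_trace (\<lambda>x. F x + G x) = lin_trace F + lin_trace G"
  by (simp add: lin_trace_def sum.distrib real_vector.representation_add default_basis)

lemma lin_trace_scale: 
  fixes F :: "'a::real_vector \<Rightarrow> 'a"
  shows "lin_trace (\<lambda>x. c *\<^sub>R F x) = c * lin_trace F"
  by (simp add: lin_trace_def sum_distrib_left real_vector.representation_scale
      default_basis)

lemma lin_trace_minus: 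
  fixes F :: "'a::real_vector \<Rightarrow> 'a"
  shows "lin_trace (\<lambda>x. - F x) = - lin_trace F"
  using lin_trace_scale[of "-1" F] by simp

lemma lin_trace_diff: 
  fixes F :: "'a::real_vector \<Rightarrow> 'a"
  shows "lin_trace (\<lambda>x. F x - G x) = lin_trace F - lin_trace G"
  using lin_trace_add[of F "\<lambda>x. - G x"] by (simp add: lin_trace_minus)

lemma lin_trace_commute:
  fixes F :: "'a::real_vector \<Rightarrow> 'a"
  assumes dim: "dim (UNIV :: 'a set) = 4" and F: "linear F" and G: "linear G"
  shows "lin_trace (\<lambda>x. F (G x)) = lin_trace (\<lambda>x. G (F x))"
proof -
  let ?B = "extend_basis {} :: 'a set"
  note B = default_basis
  note fr = basis_frame[OF B finite_basis(1)[OF dim B]]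
  let ?r = "\<lambda>b x. representation ?B x b"
  have *: "lin_trace (\<lambda>x. P (Q x)) = (\<Sum>b\<in>?B. \<Sum>c\<in>?B. ?r c (Q b) * ?r b (P c))"
    if P: "linear P" for P Q :: "'a \<Rightarrow> 'a"
  proof -
    have "?r b (P (Q b)) = (\<Sum>c\<in>?B. ?r c (Q b) * ?r b (P c))" for b
    proof -
      have "?r b (P (Q b)) = ?r b (P (\<Sum>c\<in>?B. ?r c (Q b) *\<^sub>R c))" by (simp only: fr)
      also have "\<dots> = (\<Sum>c\<in>?B. ?r c (Q b) * ?r b (P c))"
        by (simp add: linear_sum[OF P] linear_cmul[OF P] linear_sum[OF fr(1)] linear_cmul[OF fr(1)])
      finally show ?thesis .
    qed
    then show ?thesis by (simp add: lin_trace_def)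
  qed
  show ?thesis unfolding *[OF F] *[OF G] by (subst sum.swap) (simp add: mult.commute)
qed

text \<open>A spanning set of four vectors in dimension four contains a basis of four elements, hence is
  one; the functionals are its dual basis. The computations below take place in such coordinates.\<close>

lemma coordinates4:
  fixes e1 e2 e3 e4 :: "'a::real_vector"
  assumes dim: "dim (UNIV :: 'a set) = 4" and sp: "span {e1, e2, e3, e4} = UNIV"
  obtains f1 f2 f3 f4 :: "'a \<Rightarrow> real"
  where "linear f1" "linear f2" "linear f3" "linear f4"
    and "f1 e1 = 1" "f1 e2 = 0" "f1 e3 = 0" "f1 e4 = 0"
    and "f2 e1 = 0" "f2 e2 = 1" "f2 e3 = 0" "f2 e4 = 0"
    and "f3 e1 = 0" "f3 e2 = 0" "f3 e3 = 1" "f3 e4 = 0"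
    and "f4 e1 = 0" "f4 e2 = 0" "f4 e3 = 0" "f4 e4 = 1"
    and "\<And>x. x = f1 x *\<^sub>R e1 + f2 x *\<^sub>R e2 + f3 x *\<^sub>R e3 + f4 x *\<^sub>R e4"
    and "\<And>F. linear F \<Longrightarrow> lin_trace F = f1 (F e1) + f2 (F e2) + f3 (F e3) + f4 (F e4)"
proof -
  let ?S = "{e1, e2, e3, e4}"
  obtain B where B: "B \<subseteq> ?S" "independent B" "?S \<subseteq> span B"
    using real_vector.maximal_independent_subset[of ?S] by auto
  have "span B = UNIV" using real_vector.span_minimal[OF B(3)] sp by auto
  note fB = finite_basis[OF dim B(2) this]
  have le: "card ?S \<le> 4" by (simp add: card_insert_if)
  have "B = ?S" using fB B(1) le by (intro card_seteq) auto
  with fB B have S: "independent ?S" "card ?S = 4" by simp_all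
  then have ne: "e1 \<noteq> e2" "e1 \<noteq> e3" "e1 \<noteq> e4" "e2 \<noteq> e3" "e2 \<noteq> e4" "e3 \<noteq> e4"
    by (auto simp: card_insert_if split: if_splits)
  note fr = basis_frame[OF S(1) sp]
  have rb: "representation ?S b c = (if c = b then 1 else 0)" if "b \<in> ?S" for b c
    using real_vector.representation_basis[OF S(1) that] by simp
  have dec: "x = representation ?S x e1 *\<^sub>R e1 + representation ?S x e2 *\<^sub>R e2
     + representation ?S x e3 *\<^sub>R e3 + representation ?S x e4 *\<^sub>R e4" for x
    using fr(2)[of x] ne by (simp add: add_ac)
  have tr: "lin_trace F = representation ?S (F e1) e1 + representation ?S (F e2) e2
     + representation ?S (F e3) e3 + representation ?S (F e4) e4" if "linear F" for F
    using lin_trace_frame[OF dim that fr(1) fr(2)] ne by (simp add: add_ac)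
  show thesis
    by (rule that[of "\<lambda>x. representation ?S x e1" "\<lambda>x. representation ?S x e2"
        "\<lambda>x. representation ?S x e3" "\<lambda>x. representation ?S x e4"])
      (use fr(1) ne dec tr in \<open>simp_all add: rb\<close>)
qed

section \<open>The Ricci form of a pseudo-Kaehler metric\<close>

lemma alternating_bilinear_skew:
  assumes "bilinear b" and "\<And>x. b x x = 0"
  shows "b x y = - b y x"
proof -
  have "b x y + b y x = b (x + y) (x + y) - b x x - b y y"
    by (simp add: bilinear_ladd[OF assms(1)] bilinear_radd[OF assms(1)])
  then show ?thesis by (simp add: assms(2) eq_neg_iff_add_eq_0)
qed

text \<open>The Koszul form. No metric occurs in it, which is what makes the Ricci form of a pseudo-Kaehler
  metric a function of the complex structure alone.\<close>

definition koszul_form :: "('a::real_vector \<Rightarrow> 'a \<Rightarrow> 'a) \<Rightarrow> ('a \<Rightarrow> 'a) \<Rightarrow> 'a \<Rightarrow> real" where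
  "koszul_form br J x = lin_trace (\<lambda>y. br (J x) y) - lin_trace (\<lambda>y. J (br x y))"

locale kaehler4 =
  fixes br :: "'a::real_vector \<Rightarrow> 'a \<Rightarrow> 'a" and J :: "'a \<Rightarrow> 'a" and \<omega> :: "'a \<Rightarrow> 'a \<Rightarrow> real"
  assumes dim4: "dim (UNIV :: 'a set) = 4"
    and lie: "lie_bracket br"
    and cpx: "complex_structure br J"
    and sympl: "symplectic_form br \<omega>"
    and omega_J: "\<omega> (J x) (J y) = \<omega> x y"
begin

abbreviation g :: "'a \<Rightarrow> 'a \<Rightarrow> real" where "g \<equiv> kaehler_metric J \<omega>"
abbreviation D :: "'a \<Rightarrow> 'a \<Rightarrow> 'a" where "D \<equiv> levi_civita br g"
abbreviation R :: "'a \<Rightarrow> 'a \<Rightarrow> 'a \<Rightarrow> 'a" where "R \<equiv> curvature br g"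

lemma bilinear_br: "bilinear br" and br_self: "br x x = 0"
  and jacobi: "br (br x y) z + br (br y z) x + br (br z x) y = 0"
  using lie by (auto simp: lie_bracket_def)

lemma linear_J: "linear J" and JJ: "J (J x) = - x"
  and integrable: "br (J x) (J y) - br x y - J (br (J x) y) - J (br x (J y)) = 0"
  using cpx by (auto simp: complex_structure_def)

lemma bilinear_omega: "bilinear \<omega>" and omega_self: "\<omega> x x = 0"
  and omega_nondegenerate: "(\<And>y. \<omega> x y = 0) \<Longrightarrow> x = 0"
  and omega_closed: "\<omega> (br x y) z + \<omega> (br y z) x + \<omega> (br z x) y = 0"
  using sympl by (auto simp: symplectic_form_def)

lemmas br_rules = bilinear_ladd[OF bilinear_br] bilinear_radd[OF bilinear_br]
  bilinear_lmul[OF bilinear_br] bilinear_rmul[OF bilinear_br]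
  bilinear_lneg[OF bilinear_br] bilinear_rneg[OF bilinear_br]
  bilinear_lsub[OF bilinear_br] bilinear_rsub[OF bilinear_br]
  bilinear_lzero[OF bilinear_br] bilinear_rzero[OF bilinear_br]

lemmas omega_rules = bilinear_ladd[OF bilinear_omega] bilinear_radd[OF bilinear_omega]
  bilinear_lmul[OF bilinear_omega] bilinear_rmul[OF bilinear_omega]
  bilinear_lneg[OF bilinear_omega] bilinear_rneg[OF bilinear_omega]
  bilinear_lsub[OF bilinear_omega] bilinear_rsub[OF bilinear_omega]
  bilinear_lzero[OF bilinear_omega] bilinear_rzero[OF bilinear_omega]

lemmas J_rules = linear_add[OF linear_J] linear_cmul[OF linear_J] linear_neg[OF linear_J]
  linear_diff[OF linear_J] linear_0[OF linear_J] JJ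

lemma br_skew: "br x y = - br y x"
  by (rule alternating_bilinear_skew[OF bilinear_br br_self])

lemma omega_skew: "\<omega> x y = - \<omega> y x"
  by (rule alternating_bilinear_skew[OF bilinear_omega omega_self])

lemma omega_J_left: "\<omega> (J x) y = - \<omega> x (J y)"
  using omega_J[of x "J y"] by (simp add: J_rules omega_rules)

lemma g_sym: "g x y = g y x"
  using omega_J_left[of x y] omega_skew[of x "J y"] by (simp add: kaehler_metric_def)

lemma g_J: "g (J x) (J y) = g x y"
  by (simp add: kaehler_metric_def omega_J)

lemma g_J_left: "g (J x) y = - g x (J y)"
  by (simp add: kaehler_metric_def omega_J_left)

lemma bilinear_g: "bilinear g"
  by (simp add: bilinear_def linear_iff kaehler_metric_def J_rules omega_rules)

lemma g_self_J: "g x (J x) = 0" "g (J x) x = 0"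
  using omega_self by (auto simp: kaehler_metric_def g_sym[of x] J_rules omega_rules)

lemma g_nondegenerate: "(\<And>y. g x y = 0) \<Longrightarrow> x = 0"
  using omega_nondegenerate[of "J x"] JJ[of x] by (auto simp: kaehler_metric_def J_rules)

lemmas g_rules = bilinear_ladd[OF bilinear_g] bilinear_radd[OF bilinear_g]
  bilinear_lmul[OF bilinear_g] bilinear_rmul[OF bilinear_g]
  bilinear_lneg[OF bilinear_g] bilinear_rneg[OF bilinear_g]
  bilinear_lsub[OF bilinear_g] bilinear_rsub[OF bilinear_g]
  bilinear_lzero[OF bilinear_g] bilinear_rzero[OF bilinear_g]

text \<open>By polarization \<open>g w w \<noteq> 0\<close> for one of \<open>u\<close>, \<open>v\<close> and \<open>u + v\<close>; this vector is then
  normalized.\<close>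

lemma ex_unit_vector:
  assumes W: "\<And>u v. u \<in> W \<Longrightarrow> v \<in> W \<Longrightarrow> u + v \<in> W" "\<And>c u. u \<in> W \<Longrightarrow> c *\<^sub>R u \<in> W"
    and ne: "u \<in> W" "v \<in> W" "g u v \<noteq> 0"
  obtains a where "a \<in> W" "g a a = 1 \<or> g a a = -1"
proof -
  have "\<exists>w\<in>W. g w w \<noteq> 0"
  proof (rule ccontr)
    assume "\<not> ?thesis"
    then have "g u u = 0" "g v v = 0" "g (u + v) (u + v) = 0" using ne W(1) by auto
    then show False using ne(3) g_sym[of v u] by (simp add: g_rules)
  qed
  then obtain w where w: "w \<in> W" "g w w \<noteq> 0" by blast
  let ?c = "1 / sqrt \<bar>g w w\<bar>"
  have "g (?c *\<^sub>R w) (?c *\<^sub>R w) = g w w / \<bar>g w w\<bar>"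
    by (simp add: g_rules)
  then have "g (?c *\<^sub>R w) (?c *\<^sub>R w) = 1 \<or> g (?c *\<^sub>R w) (?c *\<^sub>R w) = -1"
    using w(2) by (auto simp: abs_if)
  with that[of "?c *\<^sub>R w"] W(2)[OF w(1)] show thesis by blast
qed

text \<open>The metric is \<open>J\<close>-invariant and \<open>g x (J x) = 0\<close>, so a unit vector \<open>a\<close> gives the orthonormal
  pair \<open>a, J a\<close>; a unit vector \<open>b\<close> of the orthogonal complement \<open>W\<close> gives the other pair. The
  complement contains such a vector since otherwise every vector would equal its projection \<open>p\<close> to
  the plane spanned by \<open>a\<close> and \<open>J a\<close>.\<close>

lemma ex_pseudo_orthonormal_basis:
  obtains B where "pseudo_orthonormal_basis g B" "finite B"
proof -
  have "\<exists>x::'a. x \<noteq> 0"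
  proof (rule ccontr)
    assume "\<not> ?thesis"
    then have "UNIV \<subseteq> span ({} :: 'a set)" by auto
    from real_vector.dim_le_card[OF this] show False using dim4 by simp
  qed
  then obtain x y where "g x y \<noteq> 0" using g_nondegenerate by blast
  then obtain a where a: "g a a = 1 \<or> g a a = -1"
    using ex_unit_vector[of UNIV x y] by blast
  define W where "W = {w. g w a = 0 \<and> g w (J a) = 0}"
  have "\<exists>u\<in>W. \<exists>v\<in>W. g u v \<noteq> 0"
  proof (rule ccontr)
    assume neg: "\<not> ?thesis"
    \<comment> \<open>The orthogonal projection to the plane of \<open>a\<close> and \<open>J a\<close>.\<close>
    define p where "p y = (g a a * g y a) *\<^sub>R a + (g a a * g y (J a)) *\<^sub>R J a" for y
    have sq: "g a a * t * g a a = t" for t using a by auto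
    have pW: "y - p y \<in> W" for y
      by (simp add: W_def p_def g_rules g_self_J g_J sq)
    have "y - p y = 0" for y
    proof (rule g_nondegenerate)
      fix z
      have "g (y - p y) z = g (y - p y) (z - p z) + g (y - p y) (p z)" by (simp add: g_rules)
      moreover have "g (y - p y) (p z) = 0"
        using pW[of y] unfolding W_def by (simp add: p_def[of z] g_rules)
      ultimately show "g (y - p y) z = 0" using neg pW by auto
    qed
    then have yp: "y = p y" for y by simp
    have "y \<in> span {a, J a}" for y
      by (subst yp, unfold p_def) (intro real_vector.span_add real_vector.span_scale real_vector.span_base; simp)
    then have "dim (UNIV :: 'a set) \<le> card {a, J a}"
      by (intro real_vector.dim_le_card) auto
    also have "\<dots> \<le> 2" by (simp add: card_insert_if)
    finally show False using dim4 by simp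
  qed
  then obtain u v where uv: "u \<in> W" "v \<in> W" "g u v \<noteq> 0" by blast
  obtain b where b: "b \<in> W" "g b b = 1 \<or> g b b = -1"
    using uv by (rule ex_unit_vector[rotated 2]) (auto simp: W_def g_rules)
  have ba: "g b a = 0" "g b (J a) = 0" "g (J b) a = 0" "g (J b) (J a) = 0"
    using b(1) by (simp_all add: W_def g_J g_J_left J_rules g_rules)
  have ab: "g a b = 0" "g (J a) b = 0" "g a (J b) = 0" "g (J a) (J b) = 0"
    using ba by (simp_all add: g_sym[of a] g_sym[of "J a"])
  let ?B = "{a, J a, b, J b}"
  have orth: "u = v \<or> g u v = 0" if "u \<in> ?B" "v \<in> ?B" for u v
    using that ab ba g_self_J by auto
  have unit: "g u u = 1 \<or> g u u = -1" if "u \<in> ?B" for u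
    using that a b(2) g_J by auto
  have "g a a \<noteq> 0" "g (J a) (J a) \<noteq> 0" "g b b \<noteq> 0" using a b(2) g_J[of a a] by auto
  moreover have "u \<noteq> v" if "g u u \<noteq> 0" "g u v = 0" for u v using that by auto
  ultimately have ne: "a \<noteq> J a" "a \<noteq> b" "a \<noteq> J b" "J a \<noteq> b" "J a \<noteq> J b" "b \<noteq> J b"
    using ab g_self_J by blast+
  have card: "card ?B = 4" using ne by simp
  have indep: "independent ?B"
  proof
    assume "dependent ?B"
    then obtain c v where v: "v \<in> ?B" "c v \<noteq> 0" and c: "(\<Sum>u\<in>?B. c u *\<^sub>R u) = 0"
      using real_vector.dependent_finite[of ?B] by auto
    have lg: "linear (\<lambda>x. g x v)" using bilinear_g by (simp add: bilinear_def)
    have "0 = g (\<Sum>u\<in>?B. c u *\<^sub>R u) v" unfolding c by (simp add: g_rules)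
    also have "\<dots> = (\<Sum>u\<in>?B. c u * g u v)"
      unfolding linear_sum[OF lg] by (simp only: linear_cmul[OF lg] real_scaleR_def)
    also have "\<dots> = (\<Sum>u\<in>?B. if u = v then c v * g v v else 0)"
      using orth[OF _ v(1)] by (intro sum.cong refl) (auto simp del: insert_iff)
    also have "\<dots> = c v * g v v" using v(1) by (subst sum.delta) simp_all
    finally show False using v unit[of v] by auto
  qed
  obtain C where C: "?B \<subseteq> C" "independent C" "UNIV \<subseteq> span C"
    using real_vector.maximal_independent_subset_extend[of ?B UNIV] indep by auto
  have "card C = 4" "finite C" using finite_basis[OF dim4 C(2)] C(3) by auto
  then have "?B = C" using C(1) card by (intro card_seteq) auto
  then have "span ?B = UNIV" using C(3) by auto
  then show thesis
    using that[of ?B] indep orth unit unfolding pseudo_orthonormal_basis_def by blast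
qed

lemma koszul_formula: "2 * g (D x y) z = g (br x y) z - g (br y z) x + g (br z x) y"
proof -
  obtain B where B: "pseudo_orthonormal_basis g B" "finite B" by (rule ex_pseudo_orthonormal_basis)
  show ?thesis
    by (rule levi_civita_unique[OF bilinear_br bilinear_g g_sym B, THEN iffD1, OF refl, THEN spec])
qed

lemma bilinear_D: "bilinear D"
  by (rule ex_pseudo_orthonormal_basis) (rule bilinear_levi_civita[OF bilinear_br bilinear_g g_sym])

lemmas D_rules = bilinear_ladd[OF bilinear_D] bilinear_radd[OF bilinear_D]
  bilinear_lmul[OF bilinear_D] bilinear_rmul[OF bilinear_D]
  bilinear_lneg[OF bilinear_D] bilinear_rneg[OF bilinear_D]
  bilinear_lsub[OF bilinear_D] bilinear_rsub[OF bilinear_D]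
  bilinear_lzero[OF bilinear_D] bilinear_rzero[OF bilinear_D]

lemma g_eqI: "(\<And>z. g x z = g y z) \<Longrightarrow> x = y"
  using g_nondegenerate[of "x - y"] by (simp add: g_rules)

lemma metric_connection: "g (D x y) z = - g (D x z) y"
  using koszul_formula[of x y z] koszul_formula[of x z y]
    br_skew[of x z] br_skew[of y z] br_skew[of x y]
  by (simp add: g_rules)

lemma torsion_free: "D x y - D y x = br x y"
proof (rule g_eqI)
  fix z
  show "g (D x y - D y x) z = g (br x y) z"
    using koszul_formula[of x y z] koszul_formula[of y x z]
      br_skew[of x z] br_skew[of y z] br_skew[of x y]
    by (simp add: g_rules)
qed

text \<open>The Kaehler identity \<open>\<nabla>J = 0\<close>: the Koszul formulas for \<open>\<nabla>\<^sub>x (J y)\<close> and \<open>\<nabla>\<^sub>x y\<close> differ by a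
  combination of \<open>d\<omega> x y z\<close>, \<open>d\<omega> x (J y) (J z)\<close> and the Nijenhuis tensor of \<open>y\<close>, \<open>z\<close>, all zero.\<close>

lemma J_parallel: "D x (J y) = J (D x y)"
proof (rule g_eqI)
  fix z
  have "\<omega> (br (J y) (J z) - br y z - J (br (J y) z) - J (br y (J z))) x = 0"
    by (simp add: integrable omega_rules)
  then have N: "\<omega> (br (J y) (J z)) x = \<omega> (br y z) x - \<omega> (br (J y) z) (J x) - \<omega> (br y (J z)) (J x)"
    by (simp add: omega_rules omega_J_left)
  have g: "g a b = - \<omega> a (J b)" for a b by (simp add: kaehler_metric_def omega_J_left)
  have "2 * g (D x (J y)) z = - 2 * g (D x y) (J z)"
    using koszul_formula[of x "J y" z] koszul_formula[of x y "J z"]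
      omega_closed[of x y z] omega_closed[of x "J y" "J z"] N
    by (simp add: g J_rules omega_rules)
  then show "g (D x (J y)) z = g (J (D x y)) z" by (simp add: g_J_left)
qed

lemma lin_trace_orthonormal:
  assumes B: "pseudo_orthonormal_basis g B" "finite B" and F: "linear F"
  shows "lin_trace F = (\<Sum>v\<in>B. g v v * g (F v) v)"
proof -
  have lin: "linear (\<lambda>x. g v v * g x v)" for v
    by (rule linearI) (simp_all add: g_rules algebra_simps)
  show ?thesis
    by (rule lin_trace_frame[OF dim4 F]) (use lin sum_pseudo_orthonormal[OF bilinear_g B] in auto)
qed

lemma lin_trace_skew:
  assumes F: "linear F" and skew: "\<And>x y. g (F x) y = - g (F y) x"
  shows "lin_trace F = 0"
proof -
  obtain B where B: "pseudo_orthonormal_basis g B" "finite B" by (rule ex_pseudo_orthonormal_basis)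
  have "g (F v) v = 0" for v using skew[of v v] by simp
  then show ?thesis by (simp add: lin_trace_orthonormal[OF B F])
qed

lemma linear_ops:
  "linear (D x)" "linear (\<lambda>y. D y x)" "linear (br x)" "linear (\<lambda>y. br y x)"
  "linear (R x y)" "linear (\<lambda>v. R v x y)" "linear (\<lambda>v. J (br x v))" "linear (\<lambda>v. J (D x v))"
  "linear (\<lambda>v. J (D v x))"
  by (rule linearI; simp add: curvature_def D_rules br_rules J_rules algebra_simps)+

lemma curvature_skew: "R x y z = - R y x z"
  by (simp add: curvature_def br_skew[of x y] D_rules)

lemma curvature_metric: "g (R x y z) w = - g (R x y w) z"
proof -
  have R: "g (R x y z) w = g (D x (D y z)) w - g (D y (D x z)) w - g (D (br x y) z) w" for z w
    by (simp add: curvature_def g_rules)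
  show ?thesis
    using metric_connection[of x "D y z" w] metric_connection[of y "D x z" w]
      metric_connection[of y "D x w" z] metric_connection[of x "D y w" z]
      metric_connection[of "br x y" z w]
      g_sym[of "D x w" "D y z"] g_sym[of "D y w" "D x z"] R[of z w] R[of w z]
    by linarith
qed

lemma curvature_J: "R x y (J z) = J (R x y z)"
  by (simp add: curvature_def J_parallel J_rules)

lemma first_bianchi: "R x y z + R y z x + R z x y = 0"
proof -
  have "R x y z + R y z x + R z x y
     = D x (D y z - D z y) + D y (D z x - D x z) + D z (D x y - D y x)
       - D (br x y) z - D (br y z) x - D (br z x) y"
    by (simp add: curvature_def D_rules)
  also have "\<dots> = D x (br y z) + D y (br z x) + D z (br x y)
       - D (br x y) z - D (br y z) x - D (br z x) y"
    by (simp only: torsion_free)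
  also have "\<dots> = (D x (br y z) - D (br y z) x) + (D y (br z x) - D (br z x) y)
       + (D z (br x y) - D (br x y) z)"
    by simp
  also have "\<dots> = br x (br y z) + br y (br z x) + br z (br x y)"
    by (simp only: torsion_free)
  also have "\<dots> = - (br (br x y) z + br (br y z) x + br (br z x) y)"
    using br_skew[of x "br y z"] br_skew[of y "br z x"] br_skew[of z "br x y"] by simp
  finally show ?thesis by (simp add: jacobi)
qed

lemma curvature_pair_symmetric: "g (R x y z) w = g (R z w x) y"
proof -
  have b: "g (R x y z) w + g (R y z x) w + g (R z x y) w = 0" for x y z w
    using first_bianchi[of x y z] by (metis g_rules(1) bilinear_lzero[OF bilinear_g])
  have s: "g (R x y z) w = - g (R y x z) w" for x y z w
    using curvature_skew[of x y z] by (simp add: g_rules)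
  note m = curvature_metric
  show ?thesis
    using b[of x y z w] b[of y z w x] b[of z w x y] b[of w x y z]
      s[of x y z w] s[of y z x w] s[of z x y w] s[of y z w x] s[of z w y x] s[of w y z x]
      s[of z w x y] s[of w x z y] s[of x z w y] s[of w x y z] s[of x y w z] s[of y w x z]
      m[of x y z w] m[of y z x w] m[of z x y w] m[of y z w x] m[of z w y x] m[of w y z x]
      m[of z w x y] m[of w x z y] m[of x z w y] m[of w x y z] m[of x y w z] m[of y w x z]
    by linarith
qed

lemma curvature_J_J: "R (J x) y z = - R x (J y) z"
proof (rule g_eqI)
  fix w
  show "g (R (J x) y z) w = g (- R x (J y) z) w"
    by (simp add: curvature_pair_symmetric[of "J x"] curvature_pair_symmetric[of x "J y"]
        curvature_J g_J_left g_rules)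
qed

lemma ricci_trace:
  assumes B: "pseudo_orthonormal_basis g B" "finite B"
  shows "ricci B br g x y = lin_trace (\<lambda>v. R v x y)"
  unfolding lin_trace_orthonormal[OF B linear_ops(6)] ricci_def
  by (subst curvature_skew) (simp add: g_rules sum_negf)

text \<open>Write \<open>ad x\<close> as \<open>\<nabla>\<^sub>x\<close> minus \<open>v \<mapsto> \<nabla>\<^sub>v x\<close>. Since \<open>J\<close> is parallel, the second summand
  contributes equally to \<open>tr (J \<circ> ad x)\<close> and to \<open>tr (ad (J x))\<close>, and \<open>\<nabla>\<^sub>J\<^sub>x\<close> is skew.\<close>

lemma lin_trace_JD: "lin_trace (\<lambda>v. J (D x v)) = - koszul_form br J x"
proof -
  have "lin_trace (\<lambda>v. J (br x v)) = lin_trace (\<lambda>v. J (D x v)) - lin_trace (\<lambda>v. D v (J x))"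
    by (simp add: lin_trace_diff[symmetric] torsion_free[symmetric, of x] J_rules J_parallel)
  moreover have "lin_trace (\<lambda>v. br (J x) v) = lin_trace (D (J x)) - lin_trace (\<lambda>v. D v (J x))"
    by (simp add: lin_trace_diff[symmetric] torsion_free)
  moreover have "lin_trace (D (J x)) = 0"
    by (rule lin_trace_skew[OF linear_ops(1) metric_connection])
  ultimately show ?thesis by (simp add: koszul_form_def)
qed

text \<open>The commutator in the curvature does not contribute, because \<open>J\<close> commutes with \<open>\<nabla>\<close>; only
  \<open>- \<nabla>\<^bsub>[x, y]\<^esub>\<close> does.\<close>

lemma lin_trace_JR: "lin_trace (\<lambda>v. J (R x y v)) = koszul_form br J (br x y)"
proof -
  have "lin_trace (\<lambda>v. J (R x y v))
     = lin_trace (\<lambda>v. D x (J (D y v))) - lin_trace (\<lambda>v. J (D y (D x v))) - lin_trace (\<lambda>v. J (D (br x y) v))"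
    by (simp add: curvature_def J_rules J_parallel lin_trace_diff)
  moreover have "lin_trace (\<lambda>v. D x (J (D y v))) = lin_trace (\<lambda>v. J (D y (D x v)))"
    by (rule lin_trace_commute[OF dim4 linear_ops(1,8)])
  ultimately show ?thesis by (simp add: lin_trace_JD)
qed

text \<open>The third equation is the trace of \<open>curvature_J_J\<close>. The trace of the Bianchi identity, taken once
  directly and once after composition with \<open>J\<close>, gives the symmetry of the Ricci tensor and \<open>tr (J \<circ> R x y) = ric y (J x) - ric x (J y) = - 2 ric x (J y)\<close>.\<close>

lemma ricci_koszul:
  assumes B: "pseudo_orthonormal_basis g B" "finite B"
  shows "ricci B br g x (J y) = - koszul_form br J (br x y) / 2"
    and "ricci B br g x y = ricci B br g y x"
    and "ricci B br g x (J y) = - ricci B br g (J x) y"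
proof -
  have bianchi: "R x y v = R v y x - R v x y" for x y v
    using first_bianchi[of x y v] curvature_skew[of y v x] by (simp add: algebra_simps add_eq_0_iff)
  note ric = ricci_trace[OF B]
  have "lin_trace (R x y) = 0" for x y
    by (rule lin_trace_skew[OF linear_ops(5) curvature_metric])
  then have sym: "ricci B br g x y = ricci B br g y x" for x y
    using lin_trace_diff[of "\<lambda>v. R v y x" "\<lambda>v. R v x y"] by (simp add: ric bianchi[symmetric])
  then show "ricci B br g x y = ricci B br g y x" .
  have J: "ricci B br g x (J y) = - ricci B br g (J x) y" for x y
  proof -
    have "ricci B br g x (J y) = lin_trace (\<lambda>v. J (R v x y))" by (simp add: ric curvature_J)
    also have "\<dots> = lin_trace (\<lambda>v. R (J v) x y)"
      by (rule lin_trace_commute[OF dim4 linear_J linear_ops(6)])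
    also have "\<dots> = - ricci B br g (J x) y" by (simp add: ric curvature_J_J lin_trace_minus)
    finally show ?thesis .
  qed
  then show "ricci B br g x (J y) = - ricci B br g (J x) y" .
  have "koszul_form br J (br x y) = lin_trace (\<lambda>v. J (R v y x) - J (R v x y))"
    by (simp add: lin_trace_JR[symmetric] bianchi[of x y] J_rules)
  also have "\<dots> = ricci B br g y (J x) - ricci B br g x (J y)"
    by (simp add: lin_trace_diff ric curvature_J)
  finally show "ricci B br g x (J y) = - koszul_form br J (br x y) / 2"
    using J[of x y] sym[of "J x" y] by simp
qed

lemma linear_koszul: "linear (koszul_form br J)"
  by (rule linearI) (simp_all add: koszul_form_def br_rules J_rules lin_trace_add lin_trace_scale algebra_simps)

text \<open>Twice the Ricci form \<open>ric (J x) y\<close>.\<close>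

definition \<theta> :: "'a \<Rightarrow> 'a \<Rightarrow> real" where "\<theta> x y = koszul_form br J (br x y)"

lemma bilinear_theta: "bilinear \<theta>"
  by (simp add: bilinear_def linear_iff \<theta>_def br_rules linear_add[OF linear_koszul] linear_cmul[OF linear_koszul])

lemma theta_J: "\<theta> (J x) (J y) = \<theta> x y"
proof -
  obtain B where B: "pseudo_orthonormal_basis g B" "finite B" by (rule ex_pseudo_orthonormal_basis)
  have ric: "\<theta> x y = - 2 * ricci B br g x (J y)" for x y
    using ricci_koszul(1)[OF B, of x y] by (simp add: \<theta>_def)
  have "\<theta> (J x) (J y) = \<theta> (- x) (- y)"
    using ricci_koszul(3)[OF B, of "J x" "J y"] ric[of "J x" "J y"] ric[of "- x" y]
      bilinear_lneg[OF bilinear_theta] bilinear_rneg[OF bilinear_theta] by (simp add: JJ)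
  then show ?thesis by (simp add: bilinear_lneg[OF bilinear_theta] bilinear_rneg[OF bilinear_theta])
qed

end

lemma einstein_of_ricci_form_flat:
  assumes "kaehler4 br J \<omega>" and "\<And>x y. koszul_form br J (br x y) = 0"
  shows "einstein br (kaehler_metric J \<omega>)"
proof -
  interpret kaehler4 br J \<omega> by fact
  obtain B where B: "pseudo_orthonormal_basis g B" "finite B" by (rule ex_pseudo_orthonormal_basis)
  have "ricci B br g x y = 0" for x y
    using ricci_koszul(1)[OF B, of x "- J y"] assms(2) by (simp add: J_rules)
  then show ?thesis unfolding einstein_def using B(1) by (intro exI[of _ B] exI[of _ 0]) simp
qed

context kaehler4
begin

lemmas theta_rules = bilinear_ladd[OF bilinear_theta] bilinear_radd[OF bilinear_theta]
  bilinear_lmul[OF bilinear_theta] bilinear_rmul[OF bilinear_theta]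
  bilinear_lneg[OF bilinear_theta] bilinear_rneg[OF bilinear_theta]
  bilinear_lsub[OF bilinear_theta] bilinear_rsub[OF bilinear_theta]
  bilinear_lzero[OF bilinear_theta] bilinear_rzero[OF bilinear_theta]

lemma theta_self: "\<theta> x x = 0"
  by (simp add: \<theta>_def br_self linear_0[OF linear_koszul])

lemma theta_skew: "\<theta> x y = - \<theta> y x"
  by (simp add: \<theta>_def br_skew[of x y] linear_neg[OF linear_koszul])

lemma theta_J_left: "\<theta> (J x) y = - \<theta> x (J y)"
  using theta_J[of x "J y"] by (simp add: J_rules theta_rules)

lemma theta_closed: "\<theta> (br x y) z + \<theta> (br y z) x + \<theta> (br z x) y = 0"
  by (simp add: \<theta>_def linear_add[OF linear_koszul, symmetric] jacobi linear_0[OF linear_koszul])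

text \<open>The Ricci form depends on \<open>J\<close> only, so \<open>\<theta>\<close>, taken as a Kaehler form, is its own
  Ricci form up to the factor. The Einstein constant is \<open>- 1 / 2\<close>.\<close>

lemma einstein_of_ricci_form_nondegenerate:
  assumes "\<And>x. (\<And>y. \<theta> x y = 0) \<Longrightarrow> x = 0"
  shows "kaehler4 br J \<theta>" "einstein br (kaehler_metric J \<theta>)"
proof -
  show K: "kaehler4 br J \<theta>"
    by unfold_locales
      (use dim4 lie cpx bilinear_theta theta_self theta_closed theta_J assms in
        \<open>auto simp: symplectic_form_def\<close>)
  interpret K: kaehler4 br J \<theta> by (fact K)
  obtain B where B: "pseudo_orthonormal_basis K.g B" "finite B" by (rule K.ex_pseudo_orthonormal_basis)
  have "ricci B br K.g x y = (- 1 / 2) * K.g x y" for x y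
    using K.ricci_koszul(1)[OF B, of x "- J y"] theta_J_left[of x y]
    by (simp add: kaehler_metric_def \<theta>_def J_rules br_rules linear_neg[OF linear_koszul])
  then show "einstein br K.g" unfolding einstein_def using B(1) by blast
qed

end

section \<open>Lie algebras in a frame\<close>

lemma span_frameI:
  fixes e1 e2 e3 e4 :: "'a::real_vector"
  assumes dim: "dim (UNIV :: 'a set) = 4"
    and indep: "\<And>a b c d. a *\<^sub>R e1 + b *\<^sub>R e2 + c *\<^sub>R e3 + d *\<^sub>R e4 = 0
      \<Longrightarrow> a = 0 \<and> b = 0 \<and> c = 0 \<and> d = 0"
  shows "span {e1, e2, e3, e4} = UNIV"
proof -
  have ne: "e1 \<noteq> e2" "e1 \<noteq> e3" "e1 \<noteq> e4" "e2 \<noteq> e3" "e2 \<noteq> e4" "e3 \<noteq> e4"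
    using indep[of 1 "-1" 0 0] indep[of 1 0 "-1" 0] indep[of 1 0 0 "-1"]
      indep[of 0 1 "-1" 0] indep[of 0 1 0 "-1"] indep[of 0 0 1 "-1"] by auto
  let ?B = "{e1, e2, e3, e4}"
  have "independent ?B"
  proof
    assume "dependent ?B"
    then obtain c where "\<exists>v\<in>?B. c v \<noteq> 0" "(\<Sum>u\<in>?B. c u *\<^sub>R u) = 0"
      using real_vector.dependent_finite[of ?B] by auto
    then show False using indep[of "c e1" "c e2" "c e3" "c e4"] ne by (auto simp: add.assoc)
  qed
  then obtain C where C: "?B \<subseteq> C" "independent C" "UNIV \<subseteq> span C"
    using real_vector.maximal_independent_subset_extend[of ?B UNIV] by auto
  have "card C = 4" "finite C" using finite_basis[OF dim C(2)] C(3) by auto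
  then have "?B = C" using C(1) ne by (intro card_seteq) auto
  then show ?thesis using C(3) by auto
qed

lemma bracket_in_frame:
  assumes bil: "bilinear br" and self: "\<And>x. br x x = 0"
    and x: "x = x1 *\<^sub>R e1 + x2 *\<^sub>R e2 + x3 *\<^sub>R e3 + x4 *\<^sub>R e4"
    and y: "y = y1 *\<^sub>R e1 + y2 *\<^sub>R e2 + y3 *\<^sub>R e3 + y4 *\<^sub>R e4"
  shows "br x y = (x1 * y2 - x2 * y1) *\<^sub>R br e1 e2 + (x1 * y3 - x3 * y1) *\<^sub>R br e1 e3
      + (x1 * y4 - x4 * y1) *\<^sub>R br e1 e4 + (x2 * y3 - x3 * y2) *\<^sub>R br e2 e3
      + (x2 * y4 - x4 * y2) *\<^sub>R br e2 e4 + (x3 * y4 - x4 * y3) *\<^sub>R br e3 e4"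
proof -
  note skew = alternating_bilinear_skew[OF bil self]
  show ?thesis unfolding x y
    by (simp add: bilinear_ladd[OF bil] bilinear_radd[OF bil] bilinear_lmul[OF bil]
        bilinear_rmul[OF bil] self skew[of e2 e1] skew[of e3 e1] skew[of e4 e1]
        skew[of e3 e2] skew[of e4 e2] skew[of e4 e3] algebra_simps)
qed

text \<open>The vectors \<open>b12\<close>, ..., \<open>b34\<close> are the brackets of the standard basis in the model, and the
  brackets of the frame have the same coordinates.\<close>

lemma lie_isomorphic_frame:
  fixes br :: "'a::real_vector \<Rightarrow> 'a \<Rightarrow> 'a" and br' :: "real ^ 4 \<Rightarrow> real ^ 4 \<Rightarrow> real ^ 4"
  assumes dim: "dim (UNIV :: 'a set) = 4" and sp: "span {e1, e2, e3, e4} = UNIV"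
    and bil: "bilinear br" and self: "\<And>x. br x x = 0"
    and br': "\<And>x y. br' x y = (x$1 * y$2 - x$2 * y$1) *\<^sub>R b12 + (x$1 * y$3 - x$3 * y$1) *\<^sub>R b13
      + (x$1 * y$4 - x$4 * y$1) *\<^sub>R b14 + (x$2 * y$3 - x$3 * y$2) *\<^sub>R b23
      + (x$2 * y$4 - x$4 * y$2) *\<^sub>R b24 + (x$3 * y$4 - x$4 * y$3) *\<^sub>R b34"
    and b: "br e1 e2 = b12$1 *\<^sub>R e1 + b12$2 *\<^sub>R e2 + b12$3 *\<^sub>R e3 + b12$4 *\<^sub>R e4"
      "br e1 e3 = b13$1 *\<^sub>R e1 + b13$2 *\<^sub>R e2 + b13$3 *\<^sub>R e3 + b13$4 *\<^sub>R e4"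
      "br e1 e4 = b14$1 *\<^sub>R e1 + b14$2 *\<^sub>R e2 + b14$3 *\<^sub>R e3 + b14$4 *\<^sub>R e4"
      "br e2 e3 = b23$1 *\<^sub>R e1 + b23$2 *\<^sub>R e2 + b23$3 *\<^sub>R e3 + b23$4 *\<^sub>R e4"
      "br e2 e4 = b24$1 *\<^sub>R e1 + b24$2 *\<^sub>R e2 + b24$3 *\<^sub>R e3 + b24$4 *\<^sub>R e4"
      "br e3 e4 = b34$1 *\<^sub>R e1 + b34$2 *\<^sub>R e2 + b34$3 *\<^sub>R e3 + b34$4 *\<^sub>R e4"
  shows "lie_isomorphic br br'"
proof -
  obtain f1 f2 f3 f4 where lin: "linear f1" "linear f2" "linear f3" "linear f4"
    and fe: "f1 e1 = 1" "f1 e2 = 0" "f1 e3 = 0" "f1 e4 = 0"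
      "f2 e1 = 0" "f2 e2 = 1" "f2 e3 = 0" "f2 e4 = 0"
      "f3 e1 = 0" "f3 e2 = 0" "f3 e3 = 1" "f3 e4 = 0"
      "f4 e1 = 0" "f4 e2 = 0" "f4 e3 = 0" "f4 e4 = 1"
    and dec: "\<And>x. x = f1 x *\<^sub>R e1 + f2 x *\<^sub>R e2 + f3 x *\<^sub>R e3 + f4 x *\<^sub>R e4"
    using coordinates4[OF dim sp] by metis
  define F :: "'a \<Rightarrow> real ^ 4" where
    "F x = f1 x *\<^sub>R axis 1 1 + f2 x *\<^sub>R axis 2 1 + f3 x *\<^sub>R axis 3 1 + f4 x *\<^sub>R axis 4 1" for x
  define h where "h v = v$1 *\<^sub>R e1 + v$2 *\<^sub>R e2 + v$3 *\<^sub>R e3 + v$4 *\<^sub>R e4" for v :: "real ^ 4"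
  have F: "F x $ 1 = f1 x" "F x $ 2 = f2 x" "F x $ 3 = f3 x" "F x $ 4 = f4 x" for x
    by (simp_all add: F_def axis_def)
  note fl = linear_add[OF lin(1)] linear_add[OF lin(2)] linear_add[OF lin(3)] linear_add[OF lin(4)]
    linear_cmul[OF lin(1)] linear_cmul[OF lin(2)] linear_cmul[OF lin(3)] linear_cmul[OF lin(4)]
  have linF: "linear F" by (rule linearI) (simp_all add: vec_eq_iff forall_4 F fl)
  have hF: "h (F x) = x" for x using dec[of x] by (simp add: h_def F)
  have Fh: "F (h v) = v" for v by (simp add: vec_eq_iff forall_4 F h_def fl fe)
  have "bij F" by (rule o_bij[of h]) (auto simp: hF Fh)
  have hom: "br (h v) (h w) = h (br' v w)" for v w
  proof -
    have "br (h v) (h w) = (v$1 * w$2 - v$2 * w$1) *\<^sub>R br e1 e2 + (v$1 * w$3 - v$3 * w$1) *\<^sub>R br e1 e3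
      + (v$1 * w$4 - v$4 * w$1) *\<^sub>R br e1 e4 + (v$2 * w$3 - v$3 * w$2) *\<^sub>R br e2 e3
      + (v$2 * w$4 - v$4 * w$2) *\<^sub>R br e2 e4 + (v$3 * w$4 - v$4 * w$3) *\<^sub>R br e3 e4"
      by (rule bracket_in_frame[OF bil self h_def h_def])
    also have "\<dots> = h (br' v w)" unfolding br' h_def b by (simp add: algebra_simps)
    finally show ?thesis .
  qed
  have "F (br x y) = br' (F x) (F y)" for x y
    using hom[of "F x" "F y"] by (simp add: hF Fh)
  then show ?thesis unfolding lie_isomorphic_def using linF \<open>bij F\<close> by blast
qed

lemma kaehler_lie_algebra_iff: 
  fixes br :: "'a::real_vector \<Rightarrow> 'a \<Rightarrow> 'a"
  assumes "dim (UNIV :: 'a set) = 4"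
  shows "kaehler_lie_algebra br J g \<longleftrightarrow> (\<exists>\<omega>. kaehler4 br J \<omega> \<and> g = kaehler_metric J \<omega>)"
  using assms by (auto simp: kaehler_lie_algebra_def kaehler4_def)

text \<open>These are the brackets of \<open>d\<^sub>4\<^sub>,\<^sub>2\<close>. The complex structure for which \<open>e1\<close>, \<open>e4\<close> span a complex line
  has a Ricci form of rank two, so another one is chosen: \<open>J\<close> maps \<open>e1\<close> to \<open>e3\<close> and \<open>e2\<close> to \<open>e4\<close>.
  Its Koszul form vanishes on all brackets, and \<open>e\<^sup>1 \<and> e\<^sup>4 + e\<^sup>2 \<and> e\<^sup>3\<close> is closed and
  \<open>J\<close>-invariant.\<close>

lemma d42_ricci_flat:
  fixes br :: "'a::real_vector \<Rightarrow> 'a \<Rightarrow> 'a"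
  assumes dim: "dim (UNIV :: 'a set) = 4" and lie: "lie_bracket br"
    and sp: "span {e1, e2, e3, e4} = UNIV"
    and b: "br e1 e2 = e3" "br e1 e3 = 0" "br e1 e4 = - 2 *\<^sub>R e1" "br e2 e3 = 0"
      "br e2 e4 = e2" "br e3 e4 = - e3"
  shows "\<exists>J g. kaehler_lie_algebra br J g \<and> einstein br g"
proof -
  obtain f1 f2 f3 f4 where lin: "linear f1" "linear f2" "linear f3" "linear f4"
    and fe: "f1 e1 = 1" "f1 e2 = 0" "f1 e3 = 0" "f1 e4 = 0"
      "f2 e1 = 0" "f2 e2 = 1" "f2 e3 = 0" "f2 e4 = 0"
      "f3 e1 = 0" "f3 e2 = 0" "f3 e3 = 1" "f3 e4 = 0"
      "f4 e1 = 0" "f4 e2 = 0" "f4 e3 = 0" "f4 e4 = 1"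
    and dec: "\<And>x. x = f1 x *\<^sub>R e1 + f2 x *\<^sub>R e2 + f3 x *\<^sub>R e3 + f4 x *\<^sub>R e4"
    and tr: "\<And>F. linear F \<Longrightarrow> lin_trace F = f1 (F e1) + f2 (F e2) + f3 (F e3) + f4 (F e4)"
    using coordinates4[OF dim sp] by metis
  note fl = linear_add[OF lin(1)] linear_add[OF lin(2)] linear_add[OF lin(3)] linear_add[OF lin(4)]
    linear_cmul[OF lin(1)] linear_cmul[OF lin(2)] linear_cmul[OF lin(3)] linear_cmul[OF lin(4)]
    linear_neg[OF lin(1)] linear_neg[OF lin(2)] linear_neg[OF lin(3)] linear_neg[OF lin(4)]
    linear_diff[OF lin(1)] linear_diff[OF lin(2)] linear_diff[OF lin(3)] linear_diff[OF lin(4)]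
    linear_0[OF lin(1)] linear_0[OF lin(2)] linear_0[OF lin(3)] linear_0[OF lin(4)]
  have bil: "bilinear br" and self: "br x x = 0" for x using lie by (auto simp: lie_bracket_def)
  have br: "br x y = (f1 x * f2 y - f2 x * f1 y) *\<^sub>R e3 - (2 * (f1 x * f4 y - f4 x * f1 y)) *\<^sub>R e1
      + (f2 x * f4 y - f4 x * f2 y) *\<^sub>R e2 - (f3 x * f4 y - f4 x * f3 y) *\<^sub>R e3" for x y
    using bracket_in_frame[OF bil self dec[of x] dec[of y]] by (simp add: b algebra_simps)
  have fbr: "f1 (br x y) = - 2 * (f1 x * f4 y - f4 x * f1 y)"
      "f2 (br x y) = f2 x * f4 y - f4 x * f2 y"
      "f3 (br x y) = f1 x * f2 y - f2 x * f1 y - (f3 x * f4 y - f4 x * f3 y)"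
      "f4 (br x y) = 0" for x y
    by (simp_all add: br fl fe)
  define J where "J x = - f3 x *\<^sub>R e1 + f4 x *\<^sub>R - e2 + f1 x *\<^sub>R e3 + f2 x *\<^sub>R e4" for x
  have fJ: "f1 (J x) = - f3 x" "f2 (J x) = - f4 x" "f3 (J x) = f1 x" "f4 (J x) = f2 x" for x
    by (simp_all add: J_def fl fe)
  have linJ: "linear J" by (rule linearI) (simp_all add: J_def fl algebra_simps)
  have eqI: "x = y" if "f1 x = f1 y" "f2 x = f2 y" "f3 x = f3 y" "f4 x = f4 y" for x y
    using dec[of x] dec[of y] that by simp
  define w where "w x y = f1 x * f4 y - f4 x * f1 y + f2 x * f3 y - f3 x * f2 y" for x y
  have K: "kaehler4 br J w"
  proof
    show "dim (UNIV :: 'a set) = 4" "lie_bracket br" by fact+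
    show "complex_structure br J" unfolding complex_structure_def
      by (intro conjI allI linJ eqI) (simp_all add: fl fJ fbr algebra_simps)
    have "bilinear w"
      by (simp add: bilinear_def linear_iff w_def fl algebra_simps)
    moreover have "x = 0" if "\<And>y. w x y = 0" for x
      using that[of e1] that[of e2] that[of e3] that[of e4] dec[of x] by (simp add: w_def fe)
    ultimately show "symplectic_form br w"
      unfolding symplectic_form_def by (auto simp: w_def fbr algebra_simps)
    show "w (J x) (J y) = w x y" for x y by (simp add: w_def fJ algebra_simps)
  qed
  interpret K: kaehler4 br J w by (fact K)
  have "koszul_form br J (br x y) = 0" for x y
    by (simp add: koszul_form_def tr K.linear_ops fbr fJ fe)
  then show ?thesis
    using einstein_of_ricci_form_flat[OF K] K kaehler_lie_algebra_iff[OF dim] by blast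
qed

section \<open>The kernel of a degenerate Ricci form\<close>

text \<open>A frame \<open>e1, J e1, e3, J e3\<close> with dual basis \<open>f1, ..., f4\<close> whose first complex line is the
  kernel of a Ricci form of rank two. Here \<open>f3\<close> and \<open>f4\<close> are coordinates on the quotient by the
  kernel.\<close>

locale kernel_frame = kaehler4 +
  fixes e1 e2 e3 e4 :: 'a and f1 f2 f3 f4 :: "'a \<Rightarrow> real"
  assumes lin: "linear f1" "linear f2" "linear f3" "linear f4"
    and fe: "f1 e1 = 1" "f1 e2 = 0" "f1 e3 = 0" "f1 e4 = 0"
      "f2 e1 = 0" "f2 e2 = 1" "f2 e3 = 0" "f2 e4 = 0"
      "f3 e1 = 0" "f3 e2 = 0" "f3 e3 = 1" "f3 e4 = 0"
      "f4 e1 = 0" "f4 e2 = 0" "f4 e3 = 0" "f4 e4 = 1"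
    and dec: "\<And>x. x = f1 x *\<^sub>R e1 + f2 x *\<^sub>R e2 + f3 x *\<^sub>R e3 + f4 x *\<^sub>R e4"
    and tr: "\<And>F. linear F \<Longrightarrow> lin_trace F = f1 (F e1) + f2 (F e2) + f3 (F e3) + f4 (F e4)"
    and J_frame: "J e1 = e2" "J e3 = e4"
    and kernel: "\<And>y. \<theta> e1 y = 0"
    and rank: "\<theta> e3 e4 \<noteq> 0"
begin

lemmas f_rules = linear_add[OF lin(1)] linear_add[OF lin(2)] linear_add[OF lin(3)] linear_add[OF lin(4)]
    linear_cmul[OF lin(1)] linear_cmul[OF lin(2)] linear_cmul[OF lin(3)] linear_cmul[OF lin(4)]
    linear_neg[OF lin(1)] linear_neg[OF lin(2)] linear_neg[OF lin(3)] linear_neg[OF lin(4)]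
    linear_diff[OF lin(1)] linear_diff[OF lin(2)] linear_diff[OF lin(3)] linear_diff[OF lin(4)]
    linear_0[OF lin(1)] linear_0[OF lin(2)] linear_0[OF lin(3)] linear_0[OF lin(4)]

lemma J_frame': "J e2 = - e1" "J e4 = - e3"
  using JJ[of e1] JJ[of e3] by (simp_all add: J_frame)

lemma f_J: "f1 (J x) = - f2 x" "f2 (J x) = f1 x" "f3 (J x) = - f4 x" "f4 (J x) = f3 x"
proof -
  have "J x = J (f1 x *\<^sub>R e1 + f2 x *\<^sub>R e2 + f3 x *\<^sub>R e3 + f4 x *\<^sub>R e4)"
    using dec[of x] by simp
  then have *: "J x = f1 x *\<^sub>R e2 - f2 x *\<^sub>R e1 + f3 x *\<^sub>R e4 - f4 x *\<^sub>R e3"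
    by (simp add: J_rules(1-5) J_frame J_frame')
  show "f1 (J x) = - f2 x" "f2 (J x) = f1 x" "f3 (J x) = - f4 x" "f4 (J x) = f3 x"
    unfolding * by (simp_all add: f_rules fe)
qed

lemma eq_by_coordinates:
  "f1 x = f1 y \<Longrightarrow> f2 x = f2 y \<Longrightarrow> f3 x = f3 y \<Longrightarrow> f4 x = f4 y \<Longrightarrow> x = y"
  using dec[of x] dec[of y] by simp

lemma kernel': "\<theta> e2 y = 0" "\<theta> y e1 = 0" "\<theta> y e2 = 0"
  using theta_J_left[of e1 y] kernel theta_skew[of y e1] theta_skew[of y e2]
  by (simp_all add: J_frame)

lemma theta_frame: "\<theta> x e3 = - f4 x * \<theta> e3 e4" "\<theta> x e4 = f3 x * \<theta> e3 e4"
proof -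
  have *: "\<theta> x y = f3 x * \<theta> e3 y + f4 x * \<theta> e4 y" for y
    by (subst dec[of x]) (simp add: theta_rules kernel kernel')
  show "\<theta> x e3 = - f4 x * \<theta> e3 e4" "\<theta> x e4 = f3 x * \<theta> e3 e4"
    using theta_skew[of e4 e3] by (simp_all add: * theta_self)
qed

lemma skew_frame: "br e2 e1 = - br e1 e2" "br e3 e1 = - br e1 e3" "br e4 e1 = - br e1 e4"
    "br e3 e2 = - br e2 e3" "br e4 e2 = - br e2 e4" "br e4 e3 = - br e3 e4"
  by (rule br_skew)+

lemma kernel_subalgebra: "br e1 e2 = f1 (br e1 e2) *\<^sub>R e1 + f2 (br e1 e2) *\<^sub>R e2"
proof -
  have "\<theta> (br e1 e2) y = 0" for y
    using theta_closed[of e1 e2 y] kernel' by (simp add: kernel)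
  then have "f3 (br e1 e2) = 0" "f4 (br e1 e2) = 0"
    using theta_frame[of "br e1 e2"] rank by simp_all
  then show ?thesis using dec[of "br e1 e2"] by simp
qed

text \<open>On the quotient by the kernel, \<open>\<theta>\<close> is a volume form. Being closed it is preserved by the
  action of the kernel.\<close>

lemma kernel_action_trace_free:
  "f3 (br e1 e3) + f4 (br e1 e4) = 0" "f3 (br e2 e3) + f4 (br e2 e4) = 0"
proof -
  have "(f3 (br x e3) + f4 (br x e4)) * \<theta> e3 e4 = 0" if "\<And>y. \<theta> y x = 0" for x
    using theta_closed[of x e3 e4] that theta_frame[of "br x e3"] theta_frame[of "br x e4"] br_skew[of e4 x]
    by (simp add: theta_rules algebra_simps)
  then show "f3 (br e1 e3) + f4 (br e1 e4) = 0" "f3 (br e2 e3) + f4 (br e2 e4) = 0"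
    using rank kernel' by auto
qed

lemma integrability_coordinates:
  "f1 (br e2 e4) - f1 (br e1 e3) + f2 (br e2 e3) + f2 (br e1 e4) = 0"
  "f2 (br e2 e4) - f2 (br e1 e3) - f1 (br e2 e3) - f1 (br e1 e4) = 0"
  "f3 (br e2 e4) - f3 (br e1 e3) + f4 (br e2 e3) + f4 (br e1 e4) = 0"
  "f4 (br e2 e4) - f4 (br e1 e3) - f3 (br e2 e3) - f3 (br e1 e4) = 0"
proof -
  note N = integrable[of e1 e3, unfolded J_frame]
  show "f1 (br e2 e4) - f1 (br e1 e3) + f2 (br e2 e3) + f2 (br e1 e4) = 0"
    using arg_cong[OF N, of f1] by (simp add: f_rules f_J)
  show "f2 (br e2 e4) - f2 (br e1 e3) - f1 (br e2 e3) - f1 (br e1 e4) = 0"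
    using arg_cong[OF N, of f2] by (simp add: f_rules f_J)
  show "f3 (br e2 e4) - f3 (br e1 e3) + f4 (br e2 e3) + f4 (br e1 e4) = 0"
    using arg_cong[OF N, of f3] by (simp add: f_rules f_J)
  show "f4 (br e2 e4) - f4 (br e1 e3) - f3 (br e2 e3) - f3 (br e1 e4) = 0"
    using arg_cong[OF N, of f4] by (simp add: f_rules f_J)
qed

text \<open>The kernel acts on the quotient by the trace-free maps \<open>b J + Q\<close> for \<open>e1\<close> and \<open>w J + J Q\<close> for
  \<open>e2\<close>, where \<open>Q\<close> is the reflection-like part with entries \<open>m\<close> and \<open>n\<close>, which anticommutes with
  \<open>J\<close>; integrability of \<open>J\<close> couples the two. The last three equations say that this is a
  representation: \<open>[b J + Q, w J + J Q]\<close> is the image of \<open>[e1, e2]\<close>.\<close>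

lemma kernel_action:
  obtains p1 p2 b w m n where "br e1 e2 = p1 *\<^sub>R e1 + p2 *\<^sub>R e2"
    and "f3 (br e1 e3) = m" "f4 (br e1 e3) = b + n" "f3 (br e1 e4) = n - b" "f4 (br e1 e4) = - m"
    and "f3 (br e2 e3) = - n" "f4 (br e2 e3) = w + m" "f3 (br e2 e4) = m - w" "f4 (br e2 e4) = n"
    and "m * (2 * b + p1) = n * (2 * w + p2)" "n * (2 * b + p1) + m * (2 * w + p2) = 0"
    and "b * p1 + w * p2 + 2 * (m\<^sup>2 + n\<^sup>2) = 0"
proof -
  define p1 p2 m n b w where "p1 = f1 (br e1 e2)" and "p2 = f2 (br e1 e2)" and "m = f3 (br e1 e3)"
    and "n = f4 (br e2 e4)" and "b = f4 (br e1 e3) - f4 (br e2 e4)" and "w = f4 (br e2 e3) - f3 (br e1 e3)"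
  have p: "br e1 e2 = p1 *\<^sub>R e1 + p2 *\<^sub>R e2"
    unfolding p1_def p2_def by (rule kernel_subalgebra)
  have c: "f3 (br e1 e3) = m" "f4 (br e1 e3) = b + n" "f3 (br e1 e4) = n - b" "f4 (br e1 e4) = - m"
    "f3 (br e2 e3) = - n" "f4 (br e2 e3) = w + m" "f3 (br e2 e4) = m - w" "f4 (br e2 e4) = n"
    using kernel_action_trace_free integrability_coordinates(3,4)
    by (simp_all add: m_def n_def b_def w_def)
  have act: "f3 (br e1 x) = f3 x * m + f4 x * (n - b)" "f4 (br e1 x) = f3 x * (b + n) - f4 x * m"
      "f3 (br e2 x) = f4 x * (m - w) - f3 x * n" "f4 (br e2 x) = f3 x * (w + m) + f4 x * n" for x
    by (subst dec[of x]; simp add: br_rules(1-4) br_self f_rules fe p skew_frame c)+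
  have rep: "f3 (br (br e1 e2) x) = f3 (br e1 (br e2 x)) - f3 (br e2 (br e1 x))"
     "f4 (br (br e1 e2) x) = f4 (br e1 (br e2 x)) - f4 (br e2 (br e1 x))" for x
  proof -
    have "br (br e1 e2) x = br e1 (br e2 x) - br e2 (br e1 x)"
      using jacobi[of e1 e2 x] br_skew[of "br e2 x" e1] br_skew[of "br e1 x" e2] br_skew[of x e1]
      by (simp add: br_rules algebra_simps add_eq_0_iff)
    then show "f3 (br (br e1 e2) x) = f3 (br e1 (br e2 x)) - f3 (br e2 (br e1 x))"
     "f4 (br (br e1 e2) x) = f4 (br e1 (br e2 x)) - f4 (br e2 (br e1 x))"
      by (simp_all add: f_rules)
  qed
  have r3: "p1 * m - p2 * n = -2 * m * b + 2 * n * w"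
    using rep(1)[of e3] by (simp add: p br_rules f_rules act fe algebra_simps)
  have r4: "p1 * (b + n) + p2 * (w + m) = - 2 * (m * m + n * n) - 2 * (b * n + m * w)"
    using rep(2)[of e3] by (simp add: p br_rules f_rules act fe algebra_simps)
  have r5: "p1 * (n - b) + p2 * (m - w) = 2 * (m * m + n * n) - 2 * (b * n + m * w)"
    using rep(1)[of e4] by (simp add: p br_rules f_rules act fe algebra_simps)
  show thesis
    by (rule that[OF p c]) (use r3 r4 r5 in \<open>simp_all add: algebra_simps power2_eq_square\<close>)
qed

end

section \<open>Nondegenerate kernel\<close>

text \<open>The solution of the Jacobi identity when the kernel \<open>K\<close> has a complementary subalgebra \<open>L\<close>
  with \<open>[e3, e4] = e3\<close>. The numbers \<open>a\<close>, \<open>h\<close> and \<open>u\<close>, \<open>v\<close> describe the rotational and the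
  reflection-like part of the action of \<open>L\<close> on \<open>K\<close>, and \<open>b\<close>, \<open>w\<close> and \<open>m\<close>, \<open>n\<close> those of \<open>K\<close> on
  \<open>L\<close>. The equations \<open>r\<close> and \<open>s\<close> say that these are representations, and \<open>c\<close> is their
  compatibility. Either \<open>L\<close> acts by rotations, or the representation equations fix its action up
  to the phase of \<open>u + i v\<close>. In the former case \<open>c\<close> alone makes the action of \<open>K\<close> vanish. In the
  latter case \<open>c\<close> gives \<open>b\<^sup>2 + w\<^sup>2 = 16 (m\<^sup>2 + n\<^sup>2)\<close>
  whereas \<open>s\<close> would give \<open>b\<^sup>2 + w\<^sup>2 = m\<^sup>2 + n\<^sup>2\<close> for \<open>(m, n) \<noteq> 0\<close>.\<close>

lemma hyperbolic_action_scalars: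
  fixes p1 p2 a h u v b w m n :: real
  assumes r: "a + 2 * (u\<^sup>2 + v\<^sup>2) = 0" "(1 + 2 * a) * u - 2 * h * v = 0" "(1 + 2 * a) * v + 2 * h * u = 0"
    and s: "m * (2 * b + p1) = n * (2 * w + p2)" "n * (2 * b + p1) + m * (2 * w + p2) = 0"
      "b * p1 + w * p2 + 2 * (m\<^sup>2 + n\<^sup>2) = 0"
    and c: "- a * m + a * w + b * u - h * n - m - 2 * m * v - 2 * n * u + v * w = 0"
      "- a * n - b - b * v + h * m + h * w + 2 * m * u - n - 2 * n * v + u * w = 0"
      "- a * b + a * n + b * v - h * m + 2 * m * u + n - 2 * n * v - u * w = 0"
      "- a * m - b * h + b * u - h * n - m + 2 * m * v + 2 * n * u + v * w - w = 0"
  shows "b = 0" "w = 0" "m = 0" "n = 0"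
    and "a = 0 \<and> u = 0 \<and> v = 0 \<or> a = - 1 / 2 \<and> h = 0 \<and> 4 * (u\<^sup>2 + v\<^sup>2) = 1"
proof -
  \<comment> \<open>The two linear equations say \<open>(1 + 2 a + 2 i h) (u + i v) = 0\<close>.\<close>
  have "((1 + 2 * a)\<^sup>2 + 4 * h\<^sup>2) * (u\<^sup>2 + v\<^sup>2)
      = ((1 + 2 * a) * u - 2 * h * v)\<^sup>2 + ((1 + 2 * a) * v + 2 * h * u)\<^sup>2"
    by algebra
  also have "\<dots> = 0" using r by simp
  finally have "u\<^sup>2 + v\<^sup>2 = 0 \<or> (1 + 2 * a)\<^sup>2 + 4 * h\<^sup>2 = 0" unfolding mult_eq_0_iff by blast
  moreover have "u = 0 \<and> v = 0" if "u\<^sup>2 + v\<^sup>2 = 0" using that by (simp add: sum_power2_eq_zero_iff)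
  moreover have "1 + 2 * a = 0 \<and> h = 0" if "(1 + 2 * a)\<^sup>2 + 4 * h\<^sup>2 = 0"
    using that sum_power2_eq_zero_iff[of "1 + 2 * a" "2 * h"] by (simp add: power_mult_distrib)
  ultimately have "u = 0 \<and> v = 0 \<or> 1 + 2 * a = 0 \<and> h = 0" by blast
  then show alt: "a = 0 \<and> u = 0 \<and> v = 0 \<or> a = - 1 / 2 \<and> h = 0 \<and> 4 * (u\<^sup>2 + v\<^sup>2) = 1"
  proof
    assume "u = 0 \<and> v = 0"
    then show ?thesis using r(1) by simp
  next
    assume "1 + 2 * a = 0 \<and> h = 0"
    then have "a = - 1 / 2" "h = 0" by linarith+
    moreover have "4 * (u\<^sup>2 + v\<^sup>2) = 1" using r(1) \<open>a = - 1 / 2\<close> by linarith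
    ultimately show ?thesis by blast
  qed
  have "b = 0 \<and> w = 0 \<and> m = 0 \<and> n = 0" using alt
  proof
    assume "a = 0 \<and> u = 0 \<and> v = 0"
    then have m: "m = - h * n" and n: "n = h * m" and b: "b + n = h * (m + w)" and w: "m + w = - h * (b + n)"
      using c by (simp_all add: algebra_simps)
    have "(1 + h\<^sup>2) * m = 0" using m n by algebra
    moreover have "1 + h\<^sup>2 > 0" by (simp add: add_pos_nonneg)
    ultimately have "m = 0" by simp
    then have "n = 0" using n by simp
    have "(1 + h\<^sup>2) * b = 0" using b w \<open>m = 0\<close> \<open>n = 0\<close> by algebra
    then have "b = 0" using \<open>1 + h\<^sup>2 > 0\<close> by simp
    then show ?thesis using w \<open>m = 0\<close> \<open>n = 0\<close> by simp
  next
    assume "a = - 1 / 2 \<and> h = 0 \<and> 4 * (u\<^sup>2 + v\<^sup>2) = 1"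
    then have a: "a = - 1 / 2" "h = 0" and uv: "4 * (u\<^sup>2 + v\<^sup>2) = 1" by auto
    have w: "w = 8 * (m * v + n * u)" and b: "b = 8 * (m * u - n * v)"
      using c unfolding a by (simp_all add: algebra_simps)
    have "b\<^sup>2 + w\<^sup>2 = 16 * (m\<^sup>2 + n\<^sup>2) * (4 * (u\<^sup>2 + v\<^sup>2))" unfolding w b by algebra
    then have *: "b\<^sup>2 + w\<^sup>2 = 16 * (m\<^sup>2 + n\<^sup>2)" using uv by simp
    have "m\<^sup>2 + n\<^sup>2 = 0"
    proof (rule ccontr)
      assume nz: "m\<^sup>2 + n\<^sup>2 \<noteq> 0"
      have "(m\<^sup>2 + n\<^sup>2) * (2 * b + p1) = 0" "(m\<^sup>2 + n\<^sup>2) * (2 * w + p2) = 0" using s(1,2) by algebra+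
      then have "p1 = - 2 * b" "p2 = - 2 * w" using nz by auto
      then have "b\<^sup>2 + w\<^sup>2 = m\<^sup>2 + n\<^sup>2" using s(3) by (simp add: power2_eq_square)
      then show False using * nz by simp
    qed
    then show ?thesis using w b by (simp add: sum_power2_eq_zero_iff)
  qed
  then show "b = 0" "w = 0" "m = 0" "n = 0" by auto
qed

context kernel_frame
begin

lemma nondegenerate_kernel_brackets:
  assumes om: "\<omega> e1 e2 \<noteq> 0" "\<omega> e1 e3 = 0" "\<omega> e1 e4 = 0" and b34: "br e3 e4 = e3"
  obtains p1 p2 a h u v where "br e1 e2 = p1 *\<^sub>R e1 + p2 *\<^sub>R e2"
    and "br e1 e3 = - u *\<^sub>R e1 - (a + v) *\<^sub>R e2" "br e1 e4 = v *\<^sub>R e1 - (h + u) *\<^sub>R e2"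
    and "br e2 e3 = (a - v) *\<^sub>R e1 + u *\<^sub>R e2" "br e2 e4 = (h - u) *\<^sub>R e1 - v *\<^sub>R e2"
    and "a = 0 \<and> u = 0 \<and> v = 0 \<and> h * p1 = 0 \<and> h * p2 = 0
      \<or> a = - 1 / 2 \<and> h = 0 \<and> 4 * (u\<^sup>2 + v\<^sup>2) = 1 \<and> p1 = 0 \<and> p2 = 0"
proof -
  obtain p1 p2 b w m n where p: "br e1 e2 = p1 *\<^sub>R e1 + p2 *\<^sub>R e2"
    and L: "f3 (br e1 e3) = m" "f4 (br e1 e3) = b + n" "f3 (br e1 e4) = n - b" "f4 (br e1 e4) = - m"
     "f3 (br e2 e3) = - n" "f4 (br e2 e3) = w + m" "f3 (br e2 e4) = m - w" "f4 (br e2 e4) = n"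
    and rep: "m * (2 * b + p1) = n * (2 * w + p2)" "n * (2 * b + p1) + m * (2 * w + p2) = 0"
     "b * p1 + w * p2 + 2 * (m\<^sup>2 + n\<^sup>2) = 0"
    by (rule kernel_action)
  have om': "\<omega> e2 e3 = 0" "\<omega> e2 e4 = 0"
    using omega_J_left[of e1] om by (simp_all add: J_frame J_frame' omega_rules)
  have om21: "\<omega> e2 e1 = - \<omega> e1 e2" "\<omega> e4 e3 = - \<omega> e3 e4" by (rule omega_skew)+
  have om0: "\<omega> e3 e1 = 0" "\<omega> e4 e1 = 0" "\<omega> e3 e2 = 0" "\<omega> e4 e2 = 0"
    by (simp_all add: om om' omega_skew[of e3 e1] omega_skew[of e4 e1] omega_skew[of e3 e2]
        omega_skew[of e4 e2])
  obtain s t where st: "\<omega> e1 e2 = s" "\<omega> e3 e4 = t" by blast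
  have om_e: "\<omega> x e1 = - f2 x * s" "\<omega> x e2 = f1 x * s" "\<omega> x e3 = - f4 x * t" "\<omega> x e4 = f3 x * t" for x
    by (subst dec[of x]; simp add: omega_rules om om' om21 om0 st omega_self)+
  have tf: "f1 (br e1 e3) + f2 (br e2 e3) = 0" "f1 (br e1 e4) + f2 (br e2 e4) = 0"
  proof -
    have "(f1 (br e1 y) + f2 (br e2 y)) * s = 0" if "\<omega> (br e1 e2) y = 0" for y
      using omega_closed[of e1 e2 y] that br_skew[of y e1] by (simp add: om_e f_rules algebra_simps)
    then show "f1 (br e1 e3) + f2 (br e2 e3) = 0" "f1 (br e1 e4) + f2 (br e2 e4) = 0"
      using om(1) by (auto simp: p om_e st f_rules fe)
  qed
  define u v a h where "u = - f1 (br e1 e3)" and "v = f1 (br e1 e4)"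
    and "a = (f1 (br e2 e3) - f2 (br e1 e3)) / 2" and "h = (f1 (br e2 e4) - f2 (br e1 e4)) / 2"
  have K: "f1 (br e1 e3) = - u" "f2 (br e1 e3) = - (a + v)" "f1 (br e1 e4) = v" "f2 (br e1 e4) = - (h + u)"
    "f1 (br e2 e3) = a - v" "f2 (br e2 e3) = u" "f1 (br e2 e4) = h - u" "f2 (br e2 e4) = - v"
    using tf integrability_coordinates(1,2)
    by (simp_all add: u_def v_def a_def h_def field_simps)
  have B: "br e1 e3 = - u *\<^sub>R e1 - (a + v) *\<^sub>R e2 + m *\<^sub>R e3 + (b + n) *\<^sub>R e4"
    "br e1 e4 = v *\<^sub>R e1 - (h + u) *\<^sub>R e2 + (n - b) *\<^sub>R e3 - m *\<^sub>R e4"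
    "br e2 e3 = (a - v) *\<^sub>R e1 + u *\<^sub>R e2 - n *\<^sub>R e3 + (w + m) *\<^sub>R e4"
    "br e2 e4 = (h - u) *\<^sub>R e1 - v *\<^sub>R e2 + (m - w) *\<^sub>R e3 + n *\<^sub>R e4"
    by (rule eq_by_coordinates; simp add: K L f_rules fe)+
  have jac: "f (br (br x y) z + br (br y z) x + br (br z x) y) = 0" if "linear f" for f :: "'a \<Rightarrow> real" and x y z
    by (simp add: jacobi linear_0[OF that])
  note jr = br_rules skew_frame br_self p B b34 f_rules fe algebra_simps
  note j134 = jac[of _ e1 e3 e4] and j234 = jac[of _ e2 e3 e4] and j123 = jac[of _ e1 e2 e3]
    and j124 = jac[of _ e1 e2 e4]
  have r: "a + 2 * (u\<^sup>2 + v\<^sup>2) = 0" "(1 + 2 * a) * u - 2 * h * v = 0" "(1 + 2 * a) * v + 2 * h * u = 0"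
    using j134[OF lin(1)] j134[OF lin(2)] j234[OF lin(1)] by (simp_all add: jr power2_eq_square)
  note sc = hyperbolic_action_scalars[OF r rep]
  have c: "- a * m + a * w + b * u - h * n - m - 2 * m * v - 2 * n * u + v * w = 0"
      "- a * n - b - b * v + h * m + h * w + 2 * m * u - n - 2 * n * v + u * w = 0"
      "- a * b + a * n + b * v - h * m + 2 * m * u + n - 2 * n * v - u * w = 0"
      "- a * m - b * h + b * u - h * n - m + 2 * m * v + 2 * n * u + v * w - w = 0"
    using j134[OF lin(3)] j134[OF lin(4)] j234[OF lin(3)] j234[OF lin(4)] by (simp_all add: jr)
  note z = sc(1-4)[OF c] and alt = sc(5)[OF c]
  have q: "a * p2 - p1 * u - p2 * v = 0" "- a * p1 - p1 * v + p2 * u = 0"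
    "h * p2 + p1 * v - p2 * u = 0" "- h * p1 - p1 * u - p2 * v = 0"
    using j123[OF lin(1)] j123[OF lin(2)] j124[OF lin(1)] j124[OF lin(2)] z by (simp_all add: jr)
  show thesis
  proof (rule that[OF p])
    show "br e1 e3 = - u *\<^sub>R e1 - (a + v) *\<^sub>R e2" "br e1 e4 = v *\<^sub>R e1 - (h + u) *\<^sub>R e2"
      "br e2 e3 = (a - v) *\<^sub>R e1 + u *\<^sub>R e2" "br e2 e4 = (h - u) *\<^sub>R e1 - v *\<^sub>R e2"
      using B by (simp_all add: z)
    show "a = 0 \<and> u = 0 \<and> v = 0 \<and> h * p1 = 0 \<and> h * p2 = 0
      \<or> a = - 1 / 2 \<and> h = 0 \<and> 4 * (u\<^sup>2 + v\<^sup>2) = 1 \<and> p1 = 0 \<and> p2 = 0"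
      using alt q by auto
  qed
qed


text \<open>The trace formula of \<open>koszul_form\<close> with \<open>J\<close> moved to the dual basis.\<close>

lemma koszul_form_coordinates:
  "koszul_form br J x = f1 (br (J x) e1) + f2 (br (J x) e2) + f3 (br (J x) e3) + f4 (br (J x) e4)
    + f2 (br x e1) - f1 (br x e2) + f4 (br x e3) - f3 (br x e4)"
  by (simp add: koszul_form_def tr linear_ops f_J)

text \<open>The alternatives of \<open>nondegenerate_kernel_brackets\<close>. If \<open>L\<close> acts by zero, the algebra is
  \<open>K \<times> L\<close>, and \<open>K\<close> is abelian since \<open>aff(\<real>)\<close> would give \<open>\<theta> e1 e2 \<noteq> 0\<close>. Rotations of an abelian
  \<open>K\<close> by \<open>e4\<close> give \<open>r'\<^sub>4\<^sub>,\<^sub>0\<^sub>,\<^sub>\<delta>\<close>, where the sign of \<open>h\<close> decides the order of \<open>e1\<close> and \<open>e2\<close>. The hyperbolic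
  action gives \<open>d\<^sub>4\<^sub>,\<^sub>2\<close>.\<close>

lemma nondegenerate_kernel_classification:
  assumes om: "\<omega> e1 e2 \<noteq> 0" "\<omega> e1 e3 = 0" "\<omega> e1 e4 = 0" and b34: "br e3 e4 = e3"
    and no_einstein: "\<not> (\<exists>J' g'. kaehler_lie_algebra br J' g' \<and> einstein br g')"
  shows "lie_isomorphic br br_R2_aff \<or> (\<exists>\<delta>>0. lie_isomorphic br (br_r'_40 \<delta>))"
proof -
  obtain p1 p2 a h u v where B: "br e1 e2 = p1 *\<^sub>R e1 + p2 *\<^sub>R e2"
    "br e1 e3 = - u *\<^sub>R e1 - (a + v) *\<^sub>R e2" "br e1 e4 = v *\<^sub>R e1 - (h + u) *\<^sub>R e2"
    "br e2 e3 = (a - v) *\<^sub>R e1 + u *\<^sub>R e2" "br e2 e4 = (h - u) *\<^sub>R e1 - v *\<^sub>R e2"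
    and alt: "a = 0 \<and> u = 0 \<and> v = 0 \<and> h * p1 = 0 \<and> h * p2 = 0
      \<or> a = - 1 / 2 \<and> h = 0 \<and> 4 * (u\<^sup>2 + v\<^sup>2) = 1 \<and> p1 = 0 \<and> p2 = 0"
    by (rule nondegenerate_kernel_brackets[OF om b34])
  show ?thesis using alt
  proof
    assume A: "a = 0 \<and> u = 0 \<and> v = 0 \<and> h * p1 = 0 \<and> h * p2 = 0"
    show ?thesis
    proof (cases "h = 0")
      case True
      have "0 = koszul_form br J (br e1 e2)" using kernel[of e2] by (simp add: \<theta>_def)
      also have "\<dots> = - 2 * (p1\<^sup>2 + p2\<^sup>2)"
        using A True by (simp add: koszul_form_coordinates B b34 J_rules(1-5) J_frame J_frame' br_rules
            br_self skew_frame f_rules fe power2_eq_square)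
      finally have "- 2 * (p1\<^sup>2 + p2\<^sup>2) = 0" by (rule sym)
      then have "p1\<^sup>2 + p2\<^sup>2 = 0" unfolding mult_eq_0_iff by simp
      then have p: "p1 = 0" "p2 = 0" unfolding sum_power2_eq_zero_iff by blast+
      have sp: "span {- e4, e3, e1, e2} = UNIV"
      proof (rule span_frameI[OF dim4])
        fix a b c d
        assume eq: "a *\<^sub>R - e4 + b *\<^sub>R e3 + c *\<^sub>R e1 + d *\<^sub>R e2 = 0"
        show "a = 0 \<and> b = 0 \<and> c = 0 \<and> d = 0"
          using arg_cong[OF eq, of f1] arg_cong[OF eq, of f2] arg_cong[OF eq, of f3] arg_cong[OF eq, of f4]
          by (simp add: f_rules fe)
      qed
      have "lie_isomorphic br br_R2_aff"
        by (rule lie_isomorphic_frame[OF dim4 sp bilinear_br br_self,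
              where ?b12.0 = "axis 2 1" and ?b13.0 = 0 and ?b14.0 = 0 and ?b23.0 = 0 and ?b24.0 = 0 and ?b34.0 = 0])
          (use A True p in \<open>simp_all add: br_R2_aff_def axis_def br_rules skew_frame B b34\<close>)
      then show ?thesis ..
    next
      case False
      then have p: "p1 = 0" "p2 = 0" using A by auto
      define k k' where "k = (if h > 0 then e1 else e2)" and "k' = (if h > 0 then e2 else e1)"
      have sp: "span {e3, k, k', - e4} = UNIV"
      proof (rule span_frameI[OF dim4])
        fix a b c d
        assume eq: "a *\<^sub>R e3 + b *\<^sub>R k + c *\<^sub>R k' + d *\<^sub>R - e4 = 0"
        show "a = 0 \<and> b = 0 \<and> c = 0 \<and> d = 0"
          using arg_cong[OF eq, of f1] arg_cong[OF eq, of f2] arg_cong[OF eq, of f3] arg_cong[OF eq, of f4]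
          by (simp add: f_rules fe k_def k'_def split: if_splits)
      qed
      have "lie_isomorphic br (br_r'_40 \<bar>h\<bar>)"
        by (rule lie_isomorphic_frame[OF dim4 sp bilinear_br br_self, where ?b12.0 = 0 and ?b13.0 = 0
              and ?b14.0 = "- axis 1 1" and ?b23.0 = 0 and ?b24.0 = "\<bar>h\<bar> *\<^sub>R axis 3 1" and ?b34.0 = "- \<bar>h\<bar> *\<^sub>R axis 2 1"])
          (use A p in \<open>simp_all add: br_r'_40_def axis_def br_rules skew_frame B b34 k_def k'_def algebra_simps\<close>)
      then show ?thesis using False by (intro disjI2 exI[of _ "\<bar>h\<bar>"]) simp
    qed
  next
    assume "a = - 1 / 2 \<and> h = 0 \<and> 4 * (u\<^sup>2 + v\<^sup>2) = 1 \<and> p1 = 0 \<and> p2 = 0"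
    then have A: "a = - 1 / 2" "h = 0" "p1 = 0" "p2 = 0" and uv: "4 * (u\<^sup>2 + v\<^sup>2) = 1" by auto
    \<comment> \<open>A vector \<open>\<alpha> e1 + \<beta> e2\<close> of \<open>K\<close> that commutes with \<open>e3\<close>, whose action is nilpotent.\<close>
    obtain \<alpha> \<beta> where nz: "\<alpha>\<^sup>2 + \<beta>\<^sup>2 \<noteq> 0"
      and ker: "u * \<alpha> + (1 / 2 + v) * \<beta> = 0" "(1 / 2 - v) * \<alpha> + u * \<beta> = 0"
    proof (cases "v = - 1 / 2")
      case True
      then have "u = 0" using uv by (simp add: power2_eq_square)
      then show thesis using True that[of 0 1] by simp
    next
      case False
      show thesis
      proof (rule that[of "1 / 2 + v" "- u"])
        have "1 / 2 + v \<noteq> 0" using False by linarith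
        then show "(1 / 2 + v)\<^sup>2 + (- u)\<^sup>2 \<noteq> 0" by (simp add: sum_power2_eq_zero_iff)
      qed (use uv in \<open>simp_all add: algebra_simps power2_eq_square\<close>)
    qed
    define k k' where "k = \<alpha> *\<^sub>R e1 + \<beta> *\<^sub>R e2" and "k' = \<alpha> *\<^sub>R e2 - \<beta> *\<^sub>R e1"
    have sp: "span {e3, k', k, - 2 *\<^sub>R e4} = UNIV"
    proof (rule span_frameI[OF dim4])
      fix a b c d
      assume eq: "a *\<^sub>R e3 + b *\<^sub>R k' + c *\<^sub>R k + d *\<^sub>R - 2 *\<^sub>R e4 = 0"
      have f: "c * \<alpha> = b * \<beta>" "c * \<beta> = - b * \<alpha>" "a = 0" "d = 0"
        using arg_cong[OF eq, of f1] arg_cong[OF eq, of f2] arg_cong[OF eq, of f3] arg_cong[OF eq, of f4]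
        by (simp_all add: f_rules fe k_def k'_def)
      have "(\<alpha>\<^sup>2 + \<beta>\<^sup>2) * b = 0" "(\<alpha>\<^sup>2 + \<beta>\<^sup>2) * c = 0" using f(1,2) by algebra+
      then have "b = 0" "c = 0" unfolding mult_eq_0_iff using nz by blast+
      then show "a = 0 \<and> b = 0 \<and> c = 0 \<and> d = 0" using f(3,4) by blast
    qed
    have "\<exists>J g. kaehler_lie_algebra br J g \<and> einstein br g"
    proof (rule d42_ricci_flat[OF dim4 lie sp])
      note r = br_rules br_self skew_frame B b34 A k_def k'_def f_rules fe
      show "br e3 k' = k" "br e3 k = 0" "br k' k = 0" "br e3 (- 2 *\<^sub>R e4) = - 2 *\<^sub>R e3"
        "br k' (- 2 *\<^sub>R e4) = k'" "br k (- 2 *\<^sub>R e4) = - k"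
        by (rule eq_by_coordinates; use ker in \<open>simp add: r algebra_simps\<close>)+
    qed
    then show ?thesis using no_einstein by blast
  qed
qed


section \<open>Isotropic kernel\<close>

lemma null_kernel_omega:
  assumes om: "\<omega> e1 e2 = 0" "\<omega> e1 e3 = 0" "\<omega> e1 e4 = 1" and t: "\<omega> e3 e4 = t"
  shows "\<omega> x e1 = - f4 x" "\<omega> x e2 = f3 x" "\<omega> x e3 = - f2 x - t * f4 x" "\<omega> x e4 = f1 x + t * f3 x"
proof -
  have om': "\<omega> e2 e3 = - 1" "\<omega> e2 e4 = 0"
    using omega_J_left[of e1] om by (simp_all add: J_frame J_frame' omega_rules)
  show "\<omega> x e1 = - f4 x" "\<omega> x e2 = f3 x" "\<omega> x e3 = - f2 x - t * f4 x" "\<omega> x e4 = f1 x + t * f3 x"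
    by (subst dec[of x]; simp add: omega_rules om om' t omega_self omega_skew[of e2 e1]
        omega_skew[of e3 e1] omega_skew[of e4 e1] omega_skew[of e3 e2] omega_skew[of e4 e2]
        omega_skew[of e4 e3])+
qed

text \<open>For a Lagrangian kernel \<open>K\<close> the form \<open>\<omega>\<close> identifies the quotient with the dual of \<open>K\<close>, and
  closedness says that the dual of the action on the quotient is a torsion-free connection on \<open>K\<close>;
  this expresses \<open>[e1, e2]\<close> through the action. Combined with the representation equations of
  \<open>kernel_action\<close> the action must vanish.\<close>

lemma null_kernel_abelian_ideal:
  assumes om: "\<omega> e1 e2 = 0" "\<omega> e1 e3 = 0" "\<omega> e1 e4 = 1"
  shows "br e1 e2 = 0" "f3 (br e1 x) = 0" "f4 (br e1 x) = 0" "f3 (br e2 x) = 0" "f4 (br e2 x) = 0"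
proof -
  obtain p1 p2 b w m n where p: "br e1 e2 = p1 *\<^sub>R e1 + p2 *\<^sub>R e2"
    and L: "f3 (br e1 e3) = m" "f4 (br e1 e3) = b + n" "f3 (br e1 e4) = n - b" "f4 (br e1 e4) = - m"
     "f3 (br e2 e3) = - n" "f4 (br e2 e3) = w + m" "f3 (br e2 e4) = m - w" "f4 (br e2 e4) = n"
    and rep: "m * (2 * b + p1) = n * (2 * w + p2)" "n * (2 * b + p1) + m * (2 * w + p2) = 0"
     "b * p1 + w * p2 + 2 * (m\<^sup>2 + n\<^sup>2) = 0"
    by (rule kernel_action)
  obtain t where "\<omega> e3 e4 = t" by blast
  note om_e = null_kernel_omega[OF om this]
  have p12: "p2 = - w - 2 * m" "p1 = 2 * n - b"
    using omega_closed[of e1 e2 e3] omega_closed[of e1 e2 e4]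
    by (simp_all add: om_e p L f_rules fe skew_frame)
  have "m\<^sup>2 + n\<^sup>2 = 0"
  proof (rule ccontr)
    assume nz: "m\<^sup>2 + n\<^sup>2 \<noteq> 0"
    have "(m\<^sup>2 + n\<^sup>2) * (2 * b + p1) = 0" "(m\<^sup>2 + n\<^sup>2) * (2 * w + p2) = 0" using rep(1,2) by algebra+
    then have q: "p1 = - 2 * b" "p2 = - 2 * w" using nz by auto
    then have "b = - 2 * n" "w = 2 * m" using p12 by simp_all
    then have "6 * (m\<^sup>2 + n\<^sup>2) = 0" using rep(3) q by (simp add: power2_eq_square)
    then show False using nz by simp
  qed
  then have mn: "m = 0" "n = 0" unfolding sum_power2_eq_zero_iff by blast+
  then have "b\<^sup>2 + w\<^sup>2 = 0" using rep(3) p12 by algebra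
  then have bw: "b = 0" "w = 0" unfolding sum_power2_eq_zero_iff by blast+
  show p0: "br e1 e2 = 0" using p p12 mn bw by simp
  show "f3 (br e1 x) = 0" "f4 (br e1 x) = 0" "f3 (br e2 x) = 0" "f4 (br e2 x) = 0"
    by (subst dec[of x]; simp add: br_rules br_self skew_frame p0 f_rules L mn bw)+
qed

text \<open>Write the actions of \<open>e3\<close> and \<open>e4\<close> on the abelian ideal as \<open>r + q J + P\<close> and
  \<open>s + h J + J P\<close>, where \<open>P\<close> anticommutes with \<open>J\<close> and has entries \<open>u\<close>, \<open>v\<close>. Closedness of \<open>\<omega>\<close>
  and the representation equations leave three points: \<open>P = 0\<close>, \<open>v = - 1 / 2\<close> and \<open>v = 1 / 2\<close>. The
  first two, the algebras \<open>r\<^sub>4\<^sub>,\<^sub>-\<^sub>1\<^sub>,\<^sub>-\<^sub>1\<close> and \<open>d\<^sub>4\<^sub>,\<^sub>2\<close>, satisfy \<open>s + q = 1\<close>, which means \<open>\<theta> = 0\<close>.\<close>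

lemma null_kernel_classification:
  assumes om: "\<omega> e1 e2 = 0" "\<omega> e1 e3 = 0" "\<omega> e1 e4 = 1"
    and b34: "br e3 e4 = e3 + c1 *\<^sub>R e1 + c2 *\<^sub>R e2"
  shows "lie_isomorphic br br_d_41"
proof -
  note ideal = null_kernel_abelian_ideal[OF om]
  obtain t where "\<omega> e3 e4 = t" by blast
  note om_e = null_kernel_omega[OF om this]
  define r u q v s h where "r = - (f1 (br e1 e3) + f2 (br e2 e3)) / 2"
    and "u = - (f1 (br e1 e3) - f2 (br e2 e3)) / 2"
    and "q = (f1 (br e2 e3) - f2 (br e1 e3)) / 2" and "v = - (f1 (br e2 e3) + f2 (br e1 e3)) / 2"
    and "s = - (f1 (br e1 e4) + f2 (br e2 e4)) / 2" and "h = (f1 (br e2 e4) - f2 (br e1 e4)) / 2"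
  have K: "f1 (br e1 e3) = - r - u" "f2 (br e1 e3) = - q - v" "f1 (br e1 e4) = v - s" "f2 (br e1 e4) = - h - u"
    "f1 (br e2 e3) = q - v" "f2 (br e2 e3) = u - r" "f1 (br e2 e4) = h - u" "f2 (br e2 e4) = - s - v"
    using integrability_coordinates(1,2)
    by (simp_all add: r_def u_def q_def v_def s_def h_def field_simps)
  have B: "br e1 e3 = (- r - u) *\<^sub>R e1 - (q + v) *\<^sub>R e2" "br e1 e4 = (v - s) *\<^sub>R e1 - (h + u) *\<^sub>R e2"
    "br e2 e3 = (q - v) *\<^sub>R e1 + (u - r) *\<^sub>R e2" "br e2 e4 = (h - u) *\<^sub>R e1 - (s + v) *\<^sub>R e2"
    by (rule eq_by_coordinates; simp add: K ideal f_rules fe)+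
  have tors: "h = - r - 2 * u" "s = 1 + q - 2 * v"
    using omega_closed[of e1 e3 e4] omega_closed[of e2 e3 e4]
    by (simp_all add: om_e K b34 ideal f_rules fe skew_frame)
  have jac: "f (br (br x y) z + br (br y z) x + br (br z x) y) = 0" if "linear f" for f :: "'a \<Rightarrow> real" and x y z
    by (simp add: jacobi linear_0[OF that])
  note jr = br_rules skew_frame br_self ideal(1) B b34 f_rules fe algebra_simps
  have rep: "r = 0" "q + 2 * (u\<^sup>2 + v\<^sup>2) = 0" "(1 + 2 * q) * u - 2 * h * v = 0" "(1 + 2 * q) * v + 2 * h * u = 0"
    using jac[OF lin(1), of e1 e3 e4] jac[OF lin(2), of e1 e3 e4] jac[OF lin(1), of e2 e3 e4]
      jac[OF lin(2), of e2 e3 e4] by (simp_all add: jr power2_eq_square)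
  have "koszul_form br J (br e3 e4) \<noteq> 0" using rank by (simp add: \<theta>_def)
  then have nonflat: "s + q \<noteq> 1"
    by (simp add: koszul_form_coordinates jr J_rules(1-5) J_frame J_frame')
  have "u = 0 \<and> v = 1 / 2 \<and> q = - 1 / 2 \<and> s = - 1 / 2 \<and> h = 0"
  proof -
    have h: "h = - 2 * u" using tors rep(1) by simp
    have uv: "u * (1 + 2 * q + 4 * v) = 0" "(1 + 2 * q) * v = 4 * u\<^sup>2"
      using rep(3,4) unfolding h by (simp_all add: algebra_simps power2_eq_square)
    have "u = 0"
    proof (rule ccontr)
      assume "u \<noteq> 0"
      then have "1 + 2 * q = - 4 * v" using uv(1) by simp
      then have "u\<^sup>2 + v\<^sup>2 = 0" using uv(2) by algebra
      then show False using \<open>u \<noteq> 0\<close> unfolding sum_power2_eq_zero_iff by blast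
    qed
    then have q: "q = - 2 * v\<^sup>2" "(1 + 2 * q) * v = 0" using rep(2) uv(2) by simp_all
    have "v \<noteq> 0" using q(1) tors(2) nonflat by auto
    then have q2: "q = - 1 / 2" using q(2) by simp
    then have "(v - 1 / 2) * (v + 1 / 2) = 0" using q(1) by (simp add: algebra_simps power2_eq_square)
    moreover have "v + 1 / 2 \<noteq> 0" using q2 tors(2) nonflat by auto
    ultimately have "v = 1 / 2" by simp
    then show ?thesis using \<open>u = 0\<close> q2 tors(2) h by simp
  qed
  then have k: "u = 0" "v = 1 / 2" "q = - 1 / 2" "s = - 1 / 2" "h = 0" by auto
  \<comment> \<open>The terms with \<open>c1\<close> and \<open>c2\<close> absorb the kernel component of \<open>[e3, e4]\<close>.\<close>
  have sp: "span {e3 + c2 *\<^sub>R e2, e2, e1, c1 *\<^sub>R e2 - e4} = UNIV"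
  proof (rule span_frameI[OF dim4])
    fix a b c d
    assume eq: "a *\<^sub>R (e3 + c2 *\<^sub>R e2) + b *\<^sub>R e2 + c *\<^sub>R e1 + d *\<^sub>R (c1 *\<^sub>R e2 - e4) = 0"
    show "a = 0 \<and> b = 0 \<and> c = 0 \<and> d = 0"
      using arg_cong[OF eq, of f1] arg_cong[OF eq, of f2] arg_cong[OF eq, of f3] arg_cong[OF eq, of f4]
      by (simp add: f_rules fe)
  qed
  show ?thesis
    by (rule lie_isomorphic_frame[OF dim4 sp bilinear_br br_self, where ?b12.0 = "axis 3 1" and ?b13.0 = 0
          and ?b14.0 = "- axis 1 1" and ?b23.0 = 0 and ?b24.0 = 0 and ?b34.0 = "- axis 3 1"])
      (simp_all add: br_d_41_def axis_def br_rules br_self skew_frame B b34 k rep(1) ideal(1) algebra_simps)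
qed

end

section \<open>The classification\<close>

context kaehler4
begin

text \<open>If \<open>\<theta>\<close> vanished on \<open>l, J l\<close>, it would vanish on all pairs of the frame.\<close>

lemma ex_kernel_frame:
  assumes sp: "span {k, J k, l, J l} = UNIV" and kernel: "\<And>y. \<theta> k y = 0" and th: "\<theta> x0 y0 \<noteq> 0"
  obtains f1 f2 f3 f4 where "kernel_frame br J \<omega> k (J k) l (J l) f1 f2 f3 f4"
proof -
  obtain f1 f2 f3 f4 where lin: "linear f1" "linear f2" "linear f3" "linear f4"
    and fe: "f1 k = 1" "f1 (J k) = 0" "f1 l = 0" "f1 (J l) = 0"
      "f2 k = 0" "f2 (J k) = 1" "f2 l = 0" "f2 (J l) = 0"
      "f3 k = 0" "f3 (J k) = 0" "f3 l = 1" "f3 (J l) = 0"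
      "f4 k = 0" "f4 (J k) = 0" "f4 l = 0" "f4 (J l) = 1"
    and dec: "\<And>x. x = f1 x *\<^sub>R k + f2 x *\<^sub>R J k + f3 x *\<^sub>R l + f4 x *\<^sub>R J l"
    and tr: "\<And>F. linear F \<Longrightarrow> lin_trace F = f1 (F k) + f2 (F (J k)) + f3 (F l) + f4 (F (J l))"
    by (rule coordinates4[OF dim4 sp]) blast
  have kJ: "\<theta> (J k) y = 0" for y by (simp add: theta_J_left kernel theta_rules)
  have "\<theta> l (J l) \<noteq> 0"
  proof
    assume z: "\<theta> l (J l) = 0"
    have z': "\<theta> (J l) l = 0" "\<theta> y k = 0" "\<theta> y (J k) = 0" for y
      using theta_skew[of "J l" l] theta_skew[of y k] theta_skew[of y "J k"] z kernel kJ by simp_all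
    have "\<theta> x0 y0 = 0"
      by (subst dec[of x0], subst dec[of y0])
        (simp add: theta_rules kernel kJ theta_self z z')
    then show False using th by simp
  qed
  then have "kernel_frame br J \<omega> k (J k) l (J l) f1 f2 f3 f4"
    using kaehler4_axioms
    by (intro kernel_frame.intro kernel_frame_axioms.intro lin fe dec tr refl kernel) auto
  then show thesis by (rule that)
qed

lemma complex_independent:
  assumes eq: "a *\<^sub>R x + b *\<^sub>R J x = 0" and x: "x \<noteq> 0"
  shows "a = 0" "b = 0"
proof -
  have "(a\<^sup>2 + b\<^sup>2) *\<^sub>R x = a *\<^sub>R (a *\<^sub>R x + b *\<^sub>R J x) - b *\<^sub>R J (a *\<^sub>R x + b *\<^sub>R J x)"
    by (simp add: J_rules algebra_simps power2_eq_square)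
  also have "\<dots> = 0" by (simp add: eq J_rules)
  finally have "a\<^sup>2 + b\<^sup>2 = 0" using x by simp
  then show "a = 0" "b = 0" unfolding sum_power2_eq_zero_iff by blast+
qed

text \<open>Any nonzero \<open>l\<close> in the \<open>\<omega>\<close>-complement \<open>L\<close> of the kernel completes a frame. A combination of
  \<open>\<omega>\<close> and \<open>\<theta>\<close> has kernel \<open>L\<close> and is closed, so \<open>v = [l, J l]\<close> lies in \<open>L\<close>; as \<open>L\<close> is
  two-dimensional, \<open>[v, J v]\<close> is a positive multiple of \<open>v\<close>, and a multiple \<open>l'\<close> of \<open>v\<close> satisfies
  \<open>[l', J l'] = l'\<close>.\<close>

lemma nondegenerate_kernel_case:
  assumes kernel: "\<And>y. \<theta> k y = 0" and th: "\<theta> x0 y0 \<noteq> 0" and kJ: "\<omega> k (J k) \<noteq> 0"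
    and no_einstein: "\<not> (\<exists>J' g'. kaehler_lie_algebra br J' g' \<and> einstein br g')"
  shows "lie_isomorphic br br_R2_aff \<or> (\<exists>\<delta>>0. lie_isomorphic br (br_r'_40 \<delta>))"
proof -
  define s where "s = \<omega> k (J k)"
  have s: "s \<noteq> 0" "\<omega> k (J k) = s" "\<omega> (J k) k = - s"
    using kJ omega_skew[of "J k" k] by (simp_all add: s_def)
  have J_kernel: "\<theta> (J k) y = 0" for y by (simp add: theta_J_left kernel theta_rules)
  have sp: "span {k, J k, l, J l} = UNIV" if l: "\<omega> k l = 0" "\<omega> k (J l) = 0" "l \<noteq> 0" for l
  proof (rule span_frameI[OF dim4])
    fix a b c d
    assume eq: "a *\<^sub>R k + b *\<^sub>R J k + c *\<^sub>R l + d *\<^sub>R J l = 0"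
    have "b * s = 0" using arg_cong[OF eq, of "\<omega> k"] by (simp add: omega_rules omega_self l s)
    moreover have "a * s = 0"
      using arg_cong[OF eq, of "\<omega> (J k)"] by (simp add: omega_rules omega_self l s omega_J_left[of k l] omega_J)
    ultimately have ab: "a = 0" "b = 0" using s(1) by simp_all
    then show "a = 0 \<and> b = 0 \<and> c = 0 \<and> d = 0"
      using complex_independent[of c l d] eq l(3) by simp
  qed
  \<comment> \<open>The \<open>\<omega>\<close>-orthogonal projection to the kernel.\<close>
  define p where "p y = (\<omega> k y / s) *\<^sub>R J k + (\<omega> k (J y) / s) *\<^sub>R k" for y
  define l where "l = x0 - p x0"
  have l: "\<omega> k l = 0" "\<omega> k (J l) = 0"
    using s by (simp_all add: l_def p_def omega_rules omega_self J_rules)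
  have "\<theta> l y0 = \<theta> x0 y0" by (simp add: l_def p_def theta_rules kernel J_kernel)
  then have "l \<noteq> 0" using th by (auto simp: theta_rules)
  obtain f1 f2 f3 f4 where "kernel_frame br J \<omega> k (J k) l (J l) f1 f2 f3 f4"
    by (rule ex_kernel_frame[OF sp[OF l \<open>l \<noteq> 0\<close>] kernel th])
  then interpret F: kernel_frame br J \<omega> k "J k" l "J l" f1 f2 f3 f4 .
  define v x y where "v = br l (J l)" and "x = f3 v" and "y = f4 v"
  define t where "t = \<omega> l (J l)"
  have om_l: "\<omega> z l = - f4 z * t" "\<omega> z (J l) = f3 z * t" for z
    using omega_skew[of "J l" l] omega_J_left[of k l] omega_J[of k l]
    by (subst F.dec[of z]; simp add: omega_rules omega_self l t_def)+
  have om_v: "\<omega> v z = 0" if z: "\<And>u. \<theta> u z = 0" for z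
  proof -
    have "(f3 (br z l) - f4 (br (J l) z)) * \<theta> l (J l) = 0"
      using theta_closed[of l "J l" z] z F.theta_frame(1)[of "br (J l) z"] F.theta_frame(2)[of "br z l"]
      by (simp add: algebra_simps)
    then have "f3 (br z l) = f4 (br (J l) z)" using F.rank by simp
    then show ?thesis using omega_closed[of l "J l" z] by (simp add: om_l v_def)
  qed
  have "\<omega> v k = - f2 v * s" "\<omega> v (J k) = f1 v * s"
    using omega_skew[of l k] omega_skew[of "J l" k] omega_J[of l k] omega_J_left[of l k] l
    by (subst F.dec[of v]; simp add: omega_rules omega_self s)+
  then have "f1 v = 0" "f2 v = 0" using om_v[OF F.kernel'(2)] om_v[OF F.kernel'(3)] s(1) by simp_all
  then have v: "v = x *\<^sub>R l + y *\<^sub>R J l" using F.dec[of v] by (simp add: x_def y_def)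
  define r where "r = x\<^sup>2 + y\<^sup>2"
  have r: "r \<noteq> 0"
  proof
    assume "r = 0"
    then have "v = 0" unfolding r_def sum_power2_eq_zero_iff by (simp add: v)
    then show False using F.rank by (simp add: \<theta>_def v_def linear_0[OF linear_koszul])
  qed
  define l' where "l' = (1 / r) *\<^sub>R v"
  have Jv: "J v = x *\<^sub>R J l - y *\<^sub>R l" by (simp add: v J_rules)
  have "br v (J v) = r *\<^sub>R v"
    unfolding Jv by (subst v, simp add: br_rules br_self br_skew[of "J l" l] v_def[symmetric] r_def
        power2_eq_square algebra_simps)
  then have b: "br l' (J l') = l'" using r by (simp add: l'_def J_rules br_rules)
  have l': "\<omega> k l' = 0" "\<omega> k (J l') = 0" by (simp_all add: l'_def v J_rules omega_rules l)
  have "l' \<noteq> 0"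
    using r complex_independent[OF _ \<open>l \<noteq> 0\<close>, of x y] by (auto simp: l'_def v r_def)
  obtain f1' f2' f3' f4' where "kernel_frame br J \<omega> k (J k) l' (J l') f1' f2' f3' f4'"
    by (rule ex_kernel_frame[OF sp[OF l' \<open>l' \<noteq> 0\<close>] kernel th])
  then interpret F': kernel_frame br J \<omega> k "J k" l' "J l'" f1' f2' f3' f4' .
  show ?thesis by (rule F'.nondegenerate_kernel_classification[OF kJ l' b no_einstein])
qed

text \<open>A vector \<open>l\<close> with \<open>\<omega> k l = 0\<close> and \<open>\<omega> k (J l) = 1\<close> is replaced by a multiple \<open>l'\<close> of
  \<open>v = [l, J l]\<close>, for which
  \<open>[l', J l'] = l'\<close> modulo the kernel. The bracket \<open>v\<close> does not lie in the kernel, because the Koszul form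
  vanishes on a kernel that is an abelian ideal whereas \<open>\<theta> l (J l) \<noteq> 0\<close>. The generator \<open>k'\<close> of the kernel
  is then the one dual to \<open>l'\<close>.\<close>

lemma null_kernel_case:
  assumes kernel: "\<And>y. \<theta> k y = 0" and th: "\<theta> x0 y0 \<noteq> 0" and k: "k \<noteq> 0" "\<omega> k (J k) = 0"
  shows "lie_isomorphic br br_d_41"
proof -
  have sp: "span {k, J k, l, J l} = UNIV"
    if k: "\<omega> k (J k) = 0" and l: "\<omega> k l = 0" "\<omega> k (J l) = 1" for k l
  proof (rule span_frameI[OF dim4])
    have "k \<noteq> 0" using l(2) by (auto simp: omega_rules)
    fix a b c d
    assume eq: "a *\<^sub>R k + b *\<^sub>R J k + c *\<^sub>R l + d *\<^sub>R J l = 0"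
    have "d = 0" using arg_cong[OF eq, of "\<omega> k"] by (simp add: omega_rules omega_self l k)
    moreover have "c = 0"
      using arg_cong[OF eq, of "\<omega> (J k)"] omega_skew[of "J k" k]
      by (simp add: omega_rules omega_self l k omega_J_left[of k l] omega_J)
    ultimately show "a = 0 \<and> b = 0 \<and> c = 0 \<and> d = 0"
      using complex_independent[of a k b] eq \<open>k \<noteq> 0\<close> by simp
  qed
  obtain z where z: "\<omega> k z \<noteq> 0" using omega_nondegenerate[of k] k(1) by blast
  \<comment> \<open>The complex multiple \<open>l\<close> of \<open>z\<close> with \<open>\<omega> k l = 0\<close> and \<open>\<omega> k (J l) = 1\<close>.\<close>
  define A B where "A = \<omega> k z" and "B = \<omega> k (J z)"
  have AB: "A\<^sup>2 + B\<^sup>2 \<noteq> 0" using z unfolding sum_power2_eq_zero_iff A_def by blast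
  define l where "l = (1 / (A\<^sup>2 + B\<^sup>2)) *\<^sub>R (B *\<^sub>R z - A *\<^sub>R J z)"
  have l: "\<omega> k l = 0" "\<omega> k (J l) = 1"
    using AB by (simp_all add: l_def omega_rules J_rules A_def[symmetric] B_def[symmetric]
        power2_eq_square add.commute)
  obtain f1 f2 f3 f4 where "kernel_frame br J \<omega> k (J k) l (J l) f1 f2 f3 f4"
    by (rule ex_kernel_frame[OF sp[OF k(2) l] kernel th])
  then interpret F: kernel_frame br J \<omega> k "J k" l "J l" f1 f2 f3 f4 .
  note ideal = F.null_kernel_abelian_ideal[OF k(2) l]
  define v x y where "v = br l (J l)" and "x = f3 v" and "y = f4 v"
  define c where "c = f1 v *\<^sub>R k + f2 v *\<^sub>R J k"
  have v: "v = c + x *\<^sub>R l + y *\<^sub>R J l" using F.dec[of v] by (simp add: x_def y_def c_def)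
  obtain c1 c2 where c: "c = c1 *\<^sub>R k + c2 *\<^sub>R J k" using c_def by blast
  define r where "r = x\<^sup>2 + y\<^sup>2"
  have r: "r \<noteq> 0"
  proof
    assume "r = 0"
    then have "v = c" unfolding r_def sum_power2_eq_zero_iff by (simp add: v)
    moreover have "koszul_form br J c = 0"
      by (simp add: F.koszul_form_coordinates c br_rules br_self J_rules ideal F.f_rules
          br_skew[of "J k" k])
    ultimately show False using F.rank by (simp add: \<theta>_def v_def)
  qed
  define l' k' where "l' = (1 / r) *\<^sub>R v" and "k' = x *\<^sub>R k + y *\<^sub>R J k"
  have Jv: "J v = J c + x *\<^sub>R J l - y *\<^sub>R l" by (simp add: v J_rules)
  have om_Jk: "\<omega> (J k) k = 0" "\<omega> (J k) l = - 1" "\<omega> (J k) (J l) = 0"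
    using omega_skew[of "J k" k] k(2) omega_J_left[of k l] omega_J[of k l] l by simp_all
  have k': "\<omega> k' (J k') = 0" "\<omega> k' l' = 0" "\<omega> k' (J l') = 1"
    using r by (simp_all add: k'_def l'_def v c J_rules omega_rules omega_self k l om_Jk
        r_def[symmetric] power2_eq_square[symmetric])
  have kernel': "\<theta> k' y = 0" for y by (simp add: k'_def theta_rules F.kernel F.kernel')
  obtain f1' f2' f3' f4' where "kernel_frame br J \<omega> k' (J k') l' (J l') f1' f2' f3' f4'"
    by (rule ex_kernel_frame[OF sp[OF k'] kernel' th])
  then interpret F': kernel_frame br J \<omega> k' "J k'" l' "J l'" f1' f2' f3' f4' .
  \<comment> \<open>The difference \<open>w\<close> lies in the kernel of \<open>\<theta>\<close>, which is the same in both frames.\<close>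
  define w where "w = br l' (J l') - l'"
  have "f3 (br v (J v)) = r * x" "f4 (br v (J v)) = r * y"
  proof -
    have c0: "f3 (br c z) = 0" "f4 (br c z) = 0" "f3 (br (J c) z) = 0" "f4 (br (J c) z) = 0" for z
      by (simp_all add: c br_rules J_rules ideal F.f_rules)
    have c1: "f3 (br z (J c)) = 0" "f4 (br z (J c)) = 0" for z
      using c0(3,4)[of z] br_skew[of z "J c"] by (simp_all add: F.f_rules)
    have "br v (J v) = br c (J v) + br (x *\<^sub>R l + y *\<^sub>R J l) (J c) + r *\<^sub>R br l (J l)"
      by (subst v, subst (2) Jv) (simp add: Jv br_rules br_self br_skew[of "J l" l] r_def power2_eq_square algebra_simps)
    then show "f3 (br v (J v)) = r * x" "f4 (br v (J v)) = r * y"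
      by (simp_all add: F.f_rules c0 c1 x_def y_def v_def)
  qed
  then have "f3 w = 0" "f4 w = 0"
    using r by (simp_all add: w_def l'_def br_rules J_rules F.f_rules x_def y_def)
  then have "w = f1 w *\<^sub>R k + f2 w *\<^sub>R J k" using F.dec[of w] by simp
  then have "\<theta> w z = 0" for z by (metis F.kernel F.kernel'(1) add.right_neutral mult_zero_right theta_rules(1,3) real_scaleR_def)
  then have "f3' w = 0" "f4' w = 0" using F'.theta_frame[of w] F'.rank by simp_all
  then have "w = f1' w *\<^sub>R k' + f2' w *\<^sub>R J k'" using F'.dec[of w] by simp
  then have "br l' (J l') = l' + f1' w *\<^sub>R k' + f2' w *\<^sub>R J k'"
    by (simp add: w_def algebra_simps)
  then show ?thesis by (rule F'.null_kernel_classification[OF k'])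
qed

end

theorem theorem4p9:
  fixes br :: "'a::real_vector \<Rightarrow> 'a \<Rightarrow> 'a"
    and J :: "'a \<Rightarrow> 'a"
    and g :: "'a \<Rightarrow> 'a \<Rightarrow> real"
  assumes "dim (UNIV :: 'a set) = 4"
    and "kaehler_lie_algebra br J g"
    and "\<not> (\<exists>J' g'. kaehler_lie_algebra br J' g' \<and> einstein br g')"
  shows "lie_isomorphic br br_R2_aff
         \<or> (\<exists>\<delta>>0. lie_isomorphic br (br_r'_40 \<delta>))
         \<or> lie_isomorphic br br_d_41"
proof -
  obtain \<omega> where K: "kaehler4 br J \<omega>" using assms(2) kaehler_lie_algebra_iff[OF assms(1)] by blast
  interpret kaehler4 br J \<omega> by (fact K)
  have not_einstein: "\<not> einstein br (kaehler_metric J w)" if "kaehler4 br J w" for w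
    using assms(3) kaehler_lie_algebra_iff[OF assms(1)] that by blast
  obtain x0 y0 where th: "\<theta> x0 y0 \<noteq> 0"
    using not_einstein[OF K] einstein_of_ricci_form_flat[OF K] unfolding \<theta>_def by blast
  obtain k where k: "\<And>y. \<theta> k y = 0" "k \<noteq> 0"
    using not_einstein einstein_of_ricci_form_nondegenerate by blast
  show ?thesis
  proof (cases "\<omega> k (J k) = 0")
    case True
    then show ?thesis using null_kernel_case[OF k(1) th k(2)] by blast
  next
    case False
    then show ?thesis using nondegenerate_kernel_case[OF k(1) th _ assms(3)] by blast
  qed
qed

end
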